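(* Let $(R,\mathfrak m)$ be a Cohen-Macaulay local ring with infinite residue field, let $I_1$ and $I_2$ be $\mathfrak m$-primary ideals, and let $k_1,k_2$ be non-negative integers with $k_1+k_2\ge 1$. Let $x_{11},\dots,x_{1k_1}\in I_1$ and $x_{21},\dots,x_{2k_2}\in I_2$, and assume that $x_{11},\dots,x_{1k_1},x_{21},\dots,x_{2k_2}$ is a Rees-superficial sequence for $I_1$ and $I_2$. Then $$\Delta^{k_1,k_2}H_{\mathcal F}(n_1,n_2)=\ell\!\left(\frac{R}{I_1^{n_1}I_2^{n_2}+(\mathbf x_{1k_1},\mathbf x_{2k_2})}\right)-\ell\!\left(\frac{(\mathbf x_{1k_1},\mathbf x_{2k_2})\cap I_1^{n_1}I_2^{n_2}}{(\mathbf x_{1k_1})I_1^{n_1-1}I_2^{n_2}+(\mathbf x_{2k_2})I_1^{n_1}I_2^{n_2-1}}\right)+\sum_{i\ge 2}(-1)^i h_i(\mathbf x_{1k_1},\mathbf x_{2k_2})(n_1,n_2).$$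
   Context: Conventions: $I^n=R$ for $n\le 0$; $\mathcal F=\{I_1^{n_1}I_2^{n_2}\}$; $\ell$ denotes length; $H_{\mathcal F}(n_1,n_2)=\ell(R/I_1^{n_1}I_2^{n_2})$. $(\mathbf x_{1k_1})$ and $(\mathbf x_{2k_2})$ are the ideals generated by $x_{11},\dots,x_{1k_1}$ and by $x_{21},\dots,x_{2k_2}$, and $(\mathbf x_{1k_1},\mathbf x_{2k_2})$ is their sum. For $f:\mathbb Z^2\to\mathbb Z$, $$\Delta^{k_1,k_2}f(n_1,n_2)=\sum_{i=0}^{k_1+k_2}(-1)^i\sum_{j=0}^{i}\binom{k_1}{i-j}\binom{k_2}{j}f(n_1-(i-j),n_2-j).$$ The complex $C(\mathbf x_{1k_1},\mathbf x_{2k_2},\mathcal F,(n_1,n_2))$: its term in homological degree $i$ is $$\bigoplus_{j=0}^{i}\left(\frac{R}{I_1^{n_1-i+j}I_2^{n_2-j}}\right)^{\binom{k_1}{i-j}\binom{k_2}{j}},$$ the summands being indexed by pairs $(A,B)$ with $A\subseteq\{1,\dots,k_1\}$, $B\subseteq\{1,\dots,k_2\}$, $|A|=i-j$, $|B|=j$. The differential is the one induced by the Koszul complex of $R$ on $x_{11},\dots,x_{1k_1},x_{21},\dots,x_{2k_2}$. Thus it is the quotient of that Koszul complex by the subcomplex having $I_1^{n_1-|A|}I_2^{n_2-|B|}$ in the $(A,B)$ component. One sets $h_i(\mathbf x_{1k_1},\mathbf x_{2k_2})(n_1,n_2)=\ell\bigl(H_i(C(\mathbf x_{1k_1},\mathbf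 x_{2k_2},\mathcal F,(n_1,n_2)))\bigr)$. Superficial sequences: an element $x\in I_1$ is superficial for $I_1$ and $I_2$ if $(x)\cap I_1^{n_1}I_2^{n_2}=xI_1^{n_1-1}I_2^{n_2}$ for all $n_1\gg 0$ and all $n_2\ge 0$; symmetrically, $x\in I_2$ is superficial for $I_1$ and $I_2$ if $(x)\cap I_1^{n_1}I_2^{n_2}=xI_1^{n_1}I_2^{n_2-1}$ for all $n_2\gg 0$ and all $n_1\ge 0$. A sequence $y_1,\dots,y_{k_1+k_2}$ with $y_1,\dots,y_{k_1}\in I_1$ and $y_{k_1+1},\dots,y_{k_1+k_2}\in I_2$ is a (Rees-)superficial sequence for $I_1$ and $I_2$ if for each $i$ the image of $y_i$ in $R/(y_1,\dots,y_{i-1})$ is superficial for the images of $I_1$ and $I_2$.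
   Formalization: The sequence x_11,…,x_1k1,x_21,…,x_2k2 is additionally assumed to be a regular sequence; with superficiality as defined, x=0 is superficial and the formula fails (R=K[[s]], I_1=I_2=m, k_1=1, k_2=0, (n_1,n_2)=(2,0)). *)

theory Defs
  imports "HOL-Algebra.Module" "HOL-Algebra.Ideal_Product" "HOL-Algebra.Ring_Divisibility"
    "HOL-Library.Extended_Nat"
begin

section \<open>Modules, quotients and length\<close>

text \<open>The record type of modules extends that of rings; the ring multiplication and unit of a
  module play no role and are left unspecified.\<close>

definition self_module :: "('a, 'c) ring_scheme \<Rightarrow> ('a, 'a) module" where
  "self_module R = \<lparr>carrier = carrier R, monoid.mult = undefined, monoid.one = undefined,
     ring.zero = \<zero>\<^bsub>R\<^esub>, ring.add = ring.add R, smult = monoid.mult R\<rparr>"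

abbreviation sub_module :: "('a, 'b) module \<Rightarrow> 'b set \<Rightarrow> ('a, 'b) module" where
  "sub_module M H \<equiv> M\<lparr>carrier := H\<rparr>"

definition quot_module :: "('a, 'b) module \<Rightarrow> 'b set \<Rightarrow> ('a, 'b set) module" where
  "quot_module M N = \<lparr>carrier = a_rcosets\<^bsub>M\<^esub> N, monoid.mult = undefined, monoid.one = undefined,
     ring.zero = N, ring.add = set_add M, smult = (\<lambda>r U. \<Union>x\<in>U. N +>\<^bsub>M\<^esub> (r \<odot>\<^bsub>M\<^esub> x))\<rparr>"

definition module_length :: "('a, 'c) ring_scheme \<Rightarrow> ('a, 'b) module \<Rightarrow> enat" where
  "module_length R M = Sup {enat n | n. \<exists>N :: nat \<Rightarrow> 'b set.
     (\<forall>i\<le>n. submodule (N i) R M) \<and> (\<forall>i<n. N i \<subset> N (Suc i))}"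

text \<open>Integer-valued length, for modules of finite length; on a module of infinite length
  the value is unspecified.\<close>

definition len :: "('a, 'c) ring_scheme \<Rightarrow> ('a, 'b) module \<Rightarrow> int" where
  "len R M = int (the_enat (module_length R M))"

text \<open>The \<open>R\<close>-module \<open>J / K\<close> for ideals \<open>K \<subseteq> J\<close> of \<open>R\<close>.\<close>

definition ideal_quot :: "('a, 'c) ring_scheme \<Rightarrow> 'a set \<Rightarrow> 'a set \<Rightarrow> ('a, 'a set) module" where
  "ideal_quot R J K = quot_module (sub_module (self_module R) J) K"


section \<open>Cohen--Macaulay local rings\<close>

definition krull_dim :: "('a, 'c) ring_scheme \<Rightarrow> enat" where
  "krull_dim R = Sup {enat n | n. \<exists>P :: nat \<Rightarrow> 'a set.
     (\<forall>i\<le>n. primeideal (P i) R) \<and> (\<forall>i<n. P i \<subset> P (Suc i))}"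

text \<open>Sequences \<open>y\<^sub>1, \<dots>, y\<^sub>n\<close> are functions on \<open>nat\<close> of which only the values on \<open>{1..n}\<close> matter.\<close>

definition regular_sequence :: "('a, 'c) ring_scheme \<Rightarrow> nat \<Rightarrow> (nat \<Rightarrow> 'a) \<Rightarrow> bool" where
  "regular_sequence R n y \<longleftrightarrow> y ` {1..n} \<subseteq> carrier R \<and>
     (\<forall>i\<in>{1..n}. \<forall>r\<in>carrier R. y i \<otimes>\<^bsub>R\<^esub> r \<in> Idl\<^bsub>R\<^esub> (y ` {1..<i}) \<longrightarrow> r \<in> Idl\<^bsub>R\<^esub> (y ` {1..<i})) \<and>
     Idl\<^bsub>R\<^esub> (y ` {1..n}) \<noteq> carrier R"

definition depth :: "('a, 'c) ring_scheme \<Rightarrow> 'a set \<Rightarrow> enat" where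
  "depth R m = Sup {enat n | n. \<exists>y. y ` {1..n} \<subseteq> m \<and> regular_sequence R n y}"

definition noetherian_local_ring :: "('a, 'c) ring_scheme \<Rightarrow> 'a set \<Rightarrow> bool" where
  "noetherian_local_ring R m \<longleftrightarrow> cring R \<and> noetherian_ring R \<and>
     maximalideal m R \<and> (\<forall>J. maximalideal J R \<longrightarrow> J = m)"

definition cohen_macaulay_local_ring :: "('a, 'c) ring_scheme \<Rightarrow> 'a set \<Rightarrow> bool" where
  "cohen_macaulay_local_ring R m \<longleftrightarrow> noetherian_local_ring R m \<and> depth R m = krull_dim R"

definition radical :: "('a, 'c) ring_scheme \<Rightarrow> 'a set \<Rightarrow> 'a set" where
  "radical R J = {r \<in> carrier R. \<exists>n::nat. r [^]\<^bsub>R\<^esub> n \<in> J}"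

definition primary_ideal :: "('a, 'c) ring_scheme \<Rightarrow> 'a set \<Rightarrow> bool" where
  "primary_ideal R J \<longleftrightarrow> ideal J R \<and> J \<noteq> carrier R \<and>
     (\<forall>a\<in>carrier R. \<forall>b\<in>carrier R. a \<otimes>\<^bsub>R\<^esub> b \<in> J \<longrightarrow> a \<in> J \<or> b \<in> radical R J)"

definition P_primary :: "('a, 'c) ring_scheme \<Rightarrow> 'a set \<Rightarrow> 'a set \<Rightarrow> bool" where
  "P_primary R P J \<longleftrightarrow> primary_ideal R J \<and> radical R J = P"


section \<open>The filtration and its Hilbert function\<close>

text \<open>\<open>I\<^sup>n\<close> for an integer \<open>n\<close>, with \<open>I\<^sup>n = R\<close> for \<open>n \<le> 0\<close>: \<^const>\<open>nat\<close> truncates at \<open>0\<close>, and the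
  unit of the monoid of ideals is \<open>R\<close>.\<close>

definition ideal_pow :: "('a, 'c) ring_scheme \<Rightarrow> 'a set \<Rightarrow> int \<Rightarrow> 'a set" where
  "ideal_pow R I n = I [^]\<^bsub>ideals_set R\<^esub> nat n"

definition bipow :: "('a, 'c) ring_scheme \<Rightarrow> 'a set \<Rightarrow> 'a set \<Rightarrow> int \<Rightarrow> int \<Rightarrow> 'a set" where
  "bipow R I1 I2 n1 n2 = ideal_pow R I1 n1 \<cdot>\<^bsub>R\<^esub> ideal_pow R I2 n2"

definition hilb :: "('a, 'c) ring_scheme \<Rightarrow> 'a set \<Rightarrow> 'a set \<Rightarrow> int \<Rightarrow> int \<Rightarrow> int" where
  "hilb R I1 I2 n1 n2 = len R (ideal_quot R (carrier R) (bipow R I1 I2 n1 n2))"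

definition bidiff :: "nat \<Rightarrow> nat \<Rightarrow> (int \<Rightarrow> int \<Rightarrow> int) \<Rightarrow> int \<Rightarrow> int \<Rightarrow> int" where
  "bidiff k1 k2 f n1 n2 = (\<Sum>i=0..k1+k2. (- 1) ^ i *
     (\<Sum>j=0..i. int (k1 choose (i - j)) * int (k2 choose j) * f (n1 - int (i - j)) (n2 - int j)))"


section \<open>Superficial sequences\<close>

text \<open>The superficiality of \<open>x \<in> I\<close> for \<open>I\<close> and \<open>J\<close>. An element of the second ideal is superficial for
  \<open>I\<^sub>1\<close> and \<open>I\<^sub>2\<close> if \<open>superficial R I\<^sub>2 I\<^sub>1 x\<close>.

  The condition does not exclude zero divisors; in particular \<open>x = 0\<close> always satisfies it. Regularity
  of a superficial sequence is therefore not a consequence, even over a Cohen--Macaulay ring, and has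
  to be required separately where it is needed.\<close>

definition superficial :: "('a, 'c) ring_scheme \<Rightarrow> 'a set \<Rightarrow> 'a set \<Rightarrow> 'a \<Rightarrow> bool" where
  "superficial R I J x \<longleftrightarrow> x \<in> I \<and> (\<exists>N. \<forall>n1\<ge>N. \<forall>n2\<ge>0.
     PIdl\<^bsub>R\<^esub> x \<inter> bipow R I J n1 n2 = x <#\<^bsub>R\<^esub> bipow R I J (n1 - 1) n2)"

definition rees_superficial_sequence ::
  "('a, 'c) ring_scheme \<Rightarrow> 'a set \<Rightarrow> 'a set \<Rightarrow> nat \<Rightarrow> nat \<Rightarrow> (nat \<Rightarrow> 'a) \<Rightarrow> bool" where
  "rees_superficial_sequence R I1 I2 k1 k2 y \<longleftrightarrow>
     (\<forall>i\<in>{1..k1}. y i \<in> I1) \<and> (\<forall>i\<in>{k1+1..k1+k2}. y i \<in> I2) \<and>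
     (\<forall>i\<in>{1..k1+k2}.
        let K = Idl\<^bsub>R\<^esub> (y ` {1..<i}); S = R Quot K; \<pi> = (\<lambda>r. K +>\<^bsub>R\<^esub> r) in
        if i \<le> k1 then superficial S (\<pi> ` I1) (\<pi> ` I2) (\<pi> (y i))
        else superficial S (\<pi> ` I2) (\<pi> ` I1) (\<pi> (y i)))"

definition concat_seq :: "nat \<Rightarrow> (nat \<Rightarrow> 'a) \<Rightarrow> (nat \<Rightarrow> 'a) \<Rightarrow> nat \<Rightarrow> 'a" where
  "concat_seq k1 x1 x2 i = (if i \<le> k1 then x1 i else x2 (i - k1))"


section \<open>The Koszul complex and its quotient by the filtration\<close>

text \<open>Homological degrees are integers, so that the component of degree \<open>- 1\<close> is the zero module.\<close>

definition kos_index :: "nat \<Rightarrow> nat \<Rightarrow> int \<Rightarrow> (nat set \<times> nat set) set" where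
  "kos_index k1 k2 i =
     {(A, B). A \<subseteq> {1..k1} \<and> B \<subseteq> {1..k2} \<and> int (card A) + int (card B) = i}"

definition koszul :: "('a, 'c) ring_scheme \<Rightarrow> nat \<Rightarrow> nat \<Rightarrow> int \<Rightarrow>
    ('a, nat set \<times> nat set \<Rightarrow> 'a) module" where
  "koszul R k1 k2 i = \<lparr>carrier = kos_index k1 k2 i \<rightarrow>\<^sub>E carrier R,
     monoid.mult = undefined, monoid.one = undefined,
     ring.zero = (\<lambda>s\<in>kos_index k1 k2 i. \<zero>\<^bsub>R\<^esub>),
     ring.add = (\<lambda>c c'. \<lambda>s\<in>kos_index k1 k2 i. c s \<oplus>\<^bsub>R\<^esub> c' s),
     smult = (\<lambda>r c. \<lambda>s\<in>kos_index k1 k2 i. r \<otimes>\<^bsub>R\<^esub> c s)\<rparr>"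

text \<open>The Koszul differential from degree \<open>i\<close> to degree \<open>i - 1\<close>, in coordinates. The basis element
  \<open>e\<^sub>S\<close>, for \<open>S\<close> a subset of the list \<open>x1 1, \<dots>, x1 k1, x2 1, \<dots>, x2 k2\<close>, is sent to the sum over \<open>s \<in> S\<close> of
  \<open>(- 1)\<^sup>p x\<^sub>s e\<^sub>T\<close> with \<open>T = S - {s}\<close>, where \<open>p\<close> is the number of elements of \<open>S\<close> preceding \<open>s\<close>;
  every element of \<open>A\<close> precedes every element of \<open>B\<close>.\<close>

definition koszul_diff :: "('a, 'c) ring_scheme \<Rightarrow> nat \<Rightarrow> nat \<Rightarrow> (nat \<Rightarrow> 'a) \<Rightarrow> (nat \<Rightarrow> 'a) \<Rightarrow> int \<Rightarrow>
    (nat set \<times> nat set \<Rightarrow> 'a) \<Rightarrow> (nat set \<times> nat set \<Rightarrow> 'a)" where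
  "koszul_diff R k1 k2 x1 x2 i c = (\<lambda>(A, B)\<in>kos_index k1 k2 (i - 1).
     (\<Oplus>\<^bsub>R\<^esub>a\<in>{1..k1} - A. (\<ominus>\<^bsub>R\<^esub> \<one>\<^bsub>R\<^esub>) [^]\<^bsub>R\<^esub> card {t\<in>A. t < a} \<otimes>\<^bsub>R\<^esub> x1 a \<otimes>\<^bsub>R\<^esub> c (insert a A, B))
     \<oplus>\<^bsub>R\<^esub>
     (\<Oplus>\<^bsub>R\<^esub>b\<in>{1..k2} - B. (\<ominus>\<^bsub>R\<^esub> \<one>\<^bsub>R\<^esub>) [^]\<^bsub>R\<^esub> (card A + card {t\<in>B. t < b}) \<otimes>\<^bsub>R\<^esub> x2 b \<otimes>\<^bsub>R\<^esub> c (A, insert b B)))"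

definition koszul_filt :: "('a, 'c) ring_scheme \<Rightarrow> nat \<Rightarrow> nat \<Rightarrow> 'a set \<Rightarrow> 'a set \<Rightarrow> int \<Rightarrow> int \<Rightarrow> int \<Rightarrow>
    (nat set \<times> nat set \<Rightarrow> 'a) set" where
  "koszul_filt R k1 k2 I1 I2 n1 n2 i =
     (\<Pi>\<^sub>E (A, B)\<in>kos_index k1 k2 i. bipow R I1 I2 (n1 - int (card A)) (n2 - int (card B)))"

definition C_mod :: "('a, 'c) ring_scheme \<Rightarrow> nat \<Rightarrow> nat \<Rightarrow> 'a set \<Rightarrow> 'a set \<Rightarrow> int \<Rightarrow> int \<Rightarrow> int \<Rightarrow>
    ('a, (nat set \<times> nat set \<Rightarrow> 'a) set) module" where
  "C_mod R k1 k2 I1 I2 n1 n2 i =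
     quot_module (koszul R k1 k2 i) (koszul_filt R k1 k2 I1 I2 n1 n2 i)"

text \<open>The map induced on cosets by \<^const>\<open>koszul_diff\<close>: all representatives of a coset \<open>U\<close> give the
  same coset in degree \<open>i - 1\<close>.\<close>

definition C_diff :: "('a, 'c) ring_scheme \<Rightarrow> nat \<Rightarrow> nat \<Rightarrow> (nat \<Rightarrow> 'a) \<Rightarrow> (nat \<Rightarrow> 'a) \<Rightarrow>
    'a set \<Rightarrow> 'a set \<Rightarrow> int \<Rightarrow> int \<Rightarrow> int \<Rightarrow>
    (nat set \<times> nat set \<Rightarrow> 'a) set \<Rightarrow> (nat set \<times> nat set \<Rightarrow> 'a) set" where
  "C_diff R k1 k2 x1 x2 I1 I2 n1 n2 i U =
     the_elem ((\<lambda>c. koszul_filt R k1 k2 I1 I2 n1 n2 (i - 1)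
                      +>\<^bsub>koszul R k1 k2 (i - 1)\<^esub> koszul_diff R k1 k2 x1 x2 i c) ` U)"

definition C_homology :: "('a, 'c) ring_scheme \<Rightarrow> nat \<Rightarrow> nat \<Rightarrow> (nat \<Rightarrow> 'a) \<Rightarrow> (nat \<Rightarrow> 'a) \<Rightarrow>
    'a set \<Rightarrow> 'a set \<Rightarrow> int \<Rightarrow> int \<Rightarrow> int \<Rightarrow>
    ('a, (nat set \<times> nat set \<Rightarrow> 'a) set set) module" where
  "C_homology R k1 k2 x1 x2 I1 I2 n1 n2 i =
     quot_module
       (sub_module (C_mod R k1 k2 I1 I2 n1 n2 i)
          (a_kernel (C_mod R k1 k2 I1 I2 n1 n2 i) (C_mod R k1 k2 I1 I2 n1 n2 (i - 1))
             (C_diff R k1 k2 x1 x2 I1 I2 n1 n2 i)))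
       (C_diff R k1 k2 x1 x2 I1 I2 n1 n2 (i + 1) ` carrier (C_mod R k1 k2 I1 I2 n1 n2 (i + 1)))"

definition koszul_h :: "('a, 'c) ring_scheme \<Rightarrow> nat \<Rightarrow> nat \<Rightarrow> (nat \<Rightarrow> 'a) \<Rightarrow> (nat \<Rightarrow> 'a) \<Rightarrow>
    'a set \<Rightarrow> 'a set \<Rightarrow> int \<Rightarrow> int \<Rightarrow> int \<Rightarrow> int" where
  "koszul_h R k1 k2 x1 x2 I1 I2 n1 n2 i = len R (C_homology R k1 k2 x1 x2 I1 I2 n1 n2 i)"

end

theory Submission
  imports Defs
begin

text \<open>
The formula computes the Euler characteristic of a finite complex in two ways. Let \<open>K\<close> be the Koszul complex of the
concatenated sequence and \<open>F\<close> its subcomplex with component \<open>I1\<^sup>p I2\<^sup>q\<close>, \<open>p = n1 - card A\<close>, \<open>q = n2 - card B\<close>, at \<open>(A, B)\<close>. The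
term of \<open>K / F\<close> in degree \<open>i\<close> is a direct sum of quotients \<open>R / I1\<^sup>p I2\<^sup>q\<close>, and binomial coefficients count the pairs with given
cardinalities; so the alternating sum of the lengths of the terms is the difference \<open>\<Delta>\<close> of the Hilbert function. All these lengths are finite,
because \<open>m\<close> lies in the radical of every \<open>I1\<^sup>p I2\<^sup>q\<close> (\<open>finite_colength\<close>). Hence the alternating sum equals the
alternating sum of the lengths of the homology modules (\<open>bidiff_hilb_eq_euler_characteristic\<close>).

It remains to identify the homology in degrees zero and one. The former is the cokernel of \<open>K\<^sub>1 \<rightarrow> K\<^sub>0 / F\<^sub>0\<close>, that is, \<open>R\<close> modulo
\<open>I1\<^sup>n\<^sup>1 I2\<^sup>n\<^sup>2 + X\<close> for the ideal \<open>X\<close> generated by the sequence (\<open>interval_length_homology_0\<close>). For the latter, the differential maps the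
elements of \<open>K\<^sub>1\<close> with boundary in \<open>F\<^sub>0\<close> onto \<open>X \<inter> I1\<^sup>n\<^sup>1 I2\<^sup>n\<^sup>2\<close>, and it maps \<open>F\<^sub>1\<close> onto the denominator of the second length. Since the sequence is
regular, the kernel of the differential consists of boundaries from \<open>K\<^sub>2\<close> (\<open>regular_sequence_syzygy\<close>), so nothing else is lost and the first
homology is the quotient of these two ideals (\<open>interval_length_homology_1\<close>).

Lengths are handled through intervals \<open>[K, L]\<close> in the lattice of submodules of a fixed module. Additivity
(\<open>interval_length_additive\<close>) and invariance under preimages along a linear map (\<open>interval_length_preimage\<close>) are the
properties that carry the argument; \<open>module_length_subquotient\<close> translates them to quotient modules.
\<close>

section \<open>Lengths of intervals of submodules\<close>

text \<open>All modules of the theorem are subquotients of ambient modules. Measuring a subquotient \<open>L / K\<close> of \<open>M\<close>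
by chains of submodules of \<open>M\<close> between \<open>K\<close> and \<open>L\<close> keeps every computation inside \<open>M\<close>, so that
cosets, and cosets of cosets, are met only once, in the comparison with the length of a quotient module.\<close>

definition submodule_chain :: "('a, 'c) ring_scheme \<Rightarrow> ('a, 'b, 'd) module_scheme \<Rightarrow> 'b set \<Rightarrow> 'b set
    \<Rightarrow> nat \<Rightarrow> (nat \<Rightarrow> 'b set) \<Rightarrow> bool" where
  "submodule_chain R M K L n N \<longleftrightarrow>
     (\<forall>i\<le>n. submodule (N i) R M \<and> K \<subseteq> N i \<and> N i \<subseteq> L) \<and> (\<forall>i<n. N i \<subset> N (Suc i))"

definition interval_length :: "('a, 'c) ring_scheme \<Rightarrow> ('a, 'b, 'd) module_scheme \<Rightarrow> 'b set \<Rightarrow> 'b set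
    \<Rightarrow> enat" where
  "interval_length R M K L = Sup {enat n | n. \<exists>N. submodule_chain R M K L n N}"

lemma interval_length_ge: "submodule_chain R M K L n N \<Longrightarrow> enat n \<le> interval_length R M K L"
  unfolding interval_length_def by (rule Sup_upper) auto

lemma interval_length_le:
  "(\<And>n N. submodule_chain R M K L n N \<Longrightarrow> enat n \<le> b) \<Longrightarrow> interval_length R M K L \<le> b"
  unfolding interval_length_def by (rule Sup_least) auto

text \<open>A finite supremum of natural numbers is a maximum, so a finite length is the length of an actual chain;
the trivial chain \<open>K\<close> shows that the supremum is over a nonempty set.\<close>

lemma interval_length_attained:
  assumes "submodule K R M" "K \<subseteq> L" "interval_length R M K L = enat n"
  shows "\<exists>N. submodule_chain R M K L n N"
proof -
  let ?S = "{enat n | n. \<exists>N. submodule_chain R M K L n N}"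
  have "submodule_chain R M K L 0 (\<lambda>_. K)" using assms by (simp add: submodule_chain_def)
  then have ne: "?S \<noteq> {}" by blast
  have Sup: "Sup ?S = enat n" using assms(3) by (simp add: interval_length_def)
  have fin: "finite ?S" by (rule ccontr) (use Sup ne in \<open>simp only: Sup_enat_def if_False enat.distinct\<close>)
  have "Max ?S = enat n" using Sup fin ne unfolding Sup_enat_def by (simp only: if_True if_False)
  then have "enat n \<in> ?S" using Max_in[OF fin ne] by simp
  then show ?thesis by auto
qed

text \<open>Strictly monotone maps between intervals carry chains to chains. Intervals of different modules are compared
through this lemma.\<close>

lemma interval_length_map_le:
  assumes "\<And>N. submodule N R M \<Longrightarrow> K \<subseteq> N \<Longrightarrow> N \<subseteq> L \<Longrightarrow>
      submodule (g N) R' M' \<and> K' \<subseteq> g N \<and> g N \<subseteq> L'"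
    and "\<And>N N'. submodule N R M \<Longrightarrow> submodule N' R M \<Longrightarrow> K \<subseteq> N \<Longrightarrow> N \<subset> N' \<Longrightarrow> N' \<subseteq> L \<Longrightarrow> g N \<subset> g N'"
  shows "interval_length R M K L \<le> interval_length R' M' K' L'"
proof (rule interval_length_le)
  fix n N assume c: "submodule_chain R M K L n N"
  have "submodule_chain R' M' K' L' n (\<lambda>i. g (N i))"
    unfolding submodule_chain_def
  proof (intro conjI allI impI)
    fix i assume i: "i < n"
    then have "Suc i \<le> n" "i \<le> n" by auto
    then show "g (N i) \<subset> g (N (Suc i))"
      using c i unfolding submodule_chain_def by (intro assms(2)) blast+
  qed (use assms(1) c in \<open>auto simp: submodule_chain_def\<close>)
  then show "enat n \<le> interval_length R' M' K' L'" by (rule interval_length_ge)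
qed

lemma interval_length_mono:
  "K' \<subseteq> K \<Longrightarrow> L \<subseteq> L' \<Longrightarrow> interval_length R M K L \<le> interval_length R M K' L'"
  by (rule interval_length_map_le[where g = "\<lambda>N. N"]) auto

lemma interval_length_extend:
  assumes "submodule K R M" "submodule B R M" "K \<subseteq> A" "A \<subset> B"
  shows "eSuc (interval_length R M K A) \<le> interval_length R M K B"
proof (cases "interval_length R M K A")
  case (enat n)
  then obtain N where N: "submodule_chain R M K A n N"
    using interval_length_attained assms by metis
  have "submodule_chain R M K B (Suc n) (\<lambda>i. if i \<le> n then N i else B)"
    using N assms unfolding submodule_chain_def by (auto simp: le_Suc_eq less_Suc_eq_le dest: less_imp_le_nat)
      (use Suc_leI in blast)+
  then show ?thesis using interval_length_ge enat by (metis eSuc_enat)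
next
  case infinity
  then show ?thesis using interval_length_mono[of K K A B R M] assms by auto
qed

lemma interval_length_refl: "interval_length R M K K = 0"
proof -
  have "interval_length R M K K \<le> 0"
  proof (rule interval_length_le)
    fix n N assume c: "submodule_chain R M K K n N"
    show "enat n \<le> 0"
    proof (cases n)
      case (Suc m)
      then have "N 0 \<subset> N 1" "N 0 = K" "N 1 = K" using c unfolding submodule_chain_def by auto
      then show ?thesis by auto
    qed (simp add: zero_enat_def)
  qed
  then show ?thesis by simp
qed

context module begin

lemma submodule_subset: "submodule H R M \<Longrightarrow> H \<subseteq> carrier M"
  and submodule_zero: "submodule H R M \<Longrightarrow> \<zero>\<^bsub>M\<^esub> \<in> H"
  and submodule_add: "submodule H R M \<Longrightarrow> a \<in> H \<Longrightarrow> b \<in> H \<Longrightarrow> a \<oplus>\<^bsub>M\<^esub> b \<in> H"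
  and submodule_smult: "submodule H R M \<Longrightarrow> r \<in> carrier R \<Longrightarrow> b \<in> H \<Longrightarrow> r \<odot>\<^bsub>M\<^esub> b \<in> H"
  and submodule_neg: "submodule H R M \<Longrightarrow> a \<in> H \<Longrightarrow> \<ominus>\<^bsub>M\<^esub> a \<in> H"
  and submodule_diff: "submodule H R M \<Longrightarrow> a \<in> H \<Longrightarrow> b \<in> H \<Longrightarrow> a \<ominus>\<^bsub>M\<^esub> b \<in> H"
  by (auto dest: submoduleE simp: subgroup.one_closed[OF submodule.axioms(1), simplified] a_minus_def)

lemma submodule_Int: "submodule H R M \<Longrightarrow> submodule H' R M \<Longrightarrow> submodule (H \<inter> H') R M"
  by (rule submoduleI) (auto intro: submodule_subset[THEN subsetD] submodule_zero submodule_neg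
      submodule_add submodule_smult)

lemma set_add_memI: "a \<in> H \<Longrightarrow> b \<in> K \<Longrightarrow> a \<oplus>\<^bsub>M\<^esub> b \<in> H <+>\<^bsub>M\<^esub> K"
  by (auto simp: set_add_def')

lemma submodule_set_add:
  assumes H: "submodule H R M" and K: "submodule K R M"
  shows "submodule (H <+>\<^bsub>M\<^esub> K) R M"
proof (rule submoduleI)
  note [simp] = submodule_subset[OF H, THEN subsetD] submodule_subset[OF K, THEN subsetD]
  show "H <+>\<^bsub>M\<^esub> K \<subseteq> carrier M" by (auto simp: set_add_def')
  show "\<zero>\<^bsub>M\<^esub> \<in> H <+>\<^bsub>M\<^esub> K"
    using set_add_memI[OF submodule_zero[OF H] submodule_zero[OF K]] by simp
  fix a assume "a \<in> H <+>\<^bsub>M\<^esub> K"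
  then obtain h k where hk: "a = h \<oplus>\<^bsub>M\<^esub> k" "h \<in> H" "k \<in> K" by (auto simp: set_add_def')
  show "\<ominus>\<^bsub>M\<^esub> a \<in> H <+>\<^bsub>M\<^esub> K"
    using hk set_add_memI[OF submodule_neg[OF H hk(2)] submodule_neg[OF K hk(3)]]
    by (simp add: M.minus_add)
  { fix b assume "b \<in> H <+>\<^bsub>M\<^esub> K"
    then obtain h' k' where hk': "b = h' \<oplus>\<^bsub>M\<^esub> k'" "h' \<in> H" "k' \<in> K" by (auto simp: set_add_def')
    have "a \<oplus>\<^bsub>M\<^esub> b = (h \<oplus>\<^bsub>M\<^esub> h') \<oplus>\<^bsub>M\<^esub> (k \<oplus>\<^bsub>M\<^esub> k')"
      using hk hk' by (simp add: M.a_ac)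
    then show "a \<oplus>\<^bsub>M\<^esub> b \<in> H <+>\<^bsub>M\<^esub> K"
      using set_add_memI[OF submodule_add[OF H] submodule_add[OF K]] hk hk' by simp }
  { fix r assume r: "r \<in> carrier R"
    then show "r \<odot>\<^bsub>M\<^esub> a \<in> H <+>\<^bsub>M\<^esub> K"
      using hk set_add_memI[OF submodule_smult[OF H r] submodule_smult[OF K r]]
      by (simp add: smult_r_distr) }
qed

lemma set_add_subset_left: "submodule H R M \<Longrightarrow> submodule K R M \<Longrightarrow> H \<subseteq> H <+>\<^bsub>M\<^esub> K"
  using set_add_memI[OF _ submodule_zero, of _ H K] submodule_subset by fastforce

lemma set_add_subset_right: 
  assumes "submodule H R M" "submodule K R M"
  shows "K \<subseteq> H <+>\<^bsub>M\<^esub> K"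
proof
  fix x assume x: "x \<in> K"
  then have "\<zero>\<^bsub>M\<^esub> \<oplus>\<^bsub>M\<^esub> x \<in> H <+>\<^bsub>M\<^esub> K" using submodule_zero[OF assms(1)] by (rule set_add_memI[rotated])
  then show "x \<in> H <+>\<^bsub>M\<^esub> K" using x submodule_subset[OF assms(2)] by auto
qed

lemma set_add_least: "submodule L R M \<Longrightarrow> H \<subseteq> L \<Longrightarrow> K \<subseteq> L \<Longrightarrow> H <+>\<^bsub>M\<^esub> K \<subseteq> L"
  using submodule_add by (fastforce simp: set_add_def')

text \<open>The submodule lattice is modular: \<open>N \<subseteq> N'\<close> can only be strict if it stays strict after intersecting with
\<open>L\<close> or after adding \<open>L\<close>. This is what bounds a chain through \<open>K \<subseteq> T\<close> by chains below and above \<open>L\<close>.\<close>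

lemma modular_cancel:
  assumes N: "submodule N R M" and N': "submodule N' R M" and L: "submodule L R M"
    and "N \<subseteq> N'" "N' \<inter> L \<subseteq> N" "N' \<subseteq> N <+>\<^bsub>M\<^esub> L"
  shows "N' = N"
proof -
  have "x \<in> N" if x: "x \<in> N'" for x
  proof -
    obtain n l where nl: "x = n \<oplus>\<^bsub>M\<^esub> l" "n \<in> N" "l \<in> L" using x assms(6) by (auto simp: set_add_def')
    have [simp]: "n \<in> carrier M" "l \<in> carrier M" using nl submodule_subset N L by auto
    have "x \<ominus>\<^bsub>M\<^esub> n = l" using nl(1) by (simp add: a_minus_def M.a_ac M.r_neg2 M.r_neg1 M.r_neg)
    then have "l \<in> N'" using submodule_diff[OF N' x] nl(2) assms(4) by auto
    then show ?thesis using nl assms(5) submodule_add[OF N] by auto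
  qed
  then show ?thesis using assms(4) by auto
qed

text \<open>The Jordan--Hoelder type statement that length is additive on short exact sequences. For \<open>\<le>\<close>, each step of a
chain \<open>N\<^sub>0 \<subset> N\<^sub>1 \<subset> \<dots>\<close> lengthens one of the chains \<open>N\<^sub>i \<inter> L\<close> and \<open>N\<^sub>i + L\<close> by modularity. For \<open>\<ge>\<close>, a chain above \<open>L\<close>
is put on top of chains below \<open>L\<close>.\<close>

theorem interval_length_additive:
  assumes K: "submodule K R M" and L: "submodule L R M" and T: "submodule T R M"
    and KL: "K \<subseteq> L" and LT: "L \<subseteq> T"
  shows "interval_length R M K T = interval_length R M K L + interval_length R M L T"
proof (rule antisym)
  show "interval_length R M K T \<le> interval_length R M K L + interval_length R M L T"
  proof (rule interval_length_le)
    fix n N assume c: "submodule_chain R M K T n N"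
    have "enat i \<le> interval_length R M K (N i \<inter> L) + interval_length R M L (N i <+>\<^bsub>M\<^esub> L)"
      if "i \<le> n" for i
      using that
    proof (induction i)
      case 0
      then show ?case by (simp add: zero_enat_def[symmetric])
    next
      case (Suc i)
      let ?A = "N i \<inter> L" and ?A' = "N (Suc i) \<inter> L"
        and ?B = "N i <+>\<^bsub>M\<^esub> L" and ?B' = "N (Suc i) <+>\<^bsub>M\<^esub> L"
      have s: "submodule (N i) R M" "submodule (N (Suc i)) R M" "N i \<subset> N (Suc i)" "K \<subseteq> N i"
        using c Suc.prems unfolding submodule_chain_def by auto
      have AA: "?A \<subseteq> ?A'" and BB: "?B \<subseteq> ?B'" using s by (auto simp: set_add_def')
      note mono = interval_length_mono[OF subset_refl AA, of R M K]
        interval_length_mono[OF subset_refl BB, of R M L]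
      have "eSuc (interval_length R M K ?A + interval_length R M L ?B)
          \<le> interval_length R M K ?A' + interval_length R M L ?B'"
      proof (cases "?A = ?A'")
        case False
        then have "eSuc (interval_length R M K ?A) \<le> interval_length R M K ?A'"
          using AA s KL by (intro interval_length_extend K submodule_Int L) auto
        then show ?thesis using mono(2) by (metis add_mono iadd_Suc)
      next
        case True
        have "?B \<noteq> ?B'"
        proof
          assume "?B = ?B'"
          then have "N (Suc i) \<subseteq> ?B" using set_add_subset_left[OF s(2) L] by simp
          then have "N (Suc i) = N i" using True s by (intro modular_cancel[OF s(1,2) L]) auto
          then show False using s by auto
        qed
        then have "eSuc (interval_length R M L ?B) \<le> interval_length R M L ?B'"
          using BB set_add_subset_right[OF s(1) L] s
          by (intro interval_length_extend submodule_set_add L) auto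
        then show ?thesis using mono(1) by (metis add_mono iadd_Suc_right)
      qed
      moreover have "enat i \<le> interval_length R M K ?A + interval_length R M L ?B"
        using Suc by simp
      ultimately show ?case
        by (simp only: eSuc_enat[symmetric]) (rule order_trans[OF eSuc_ile_mono[THEN iffD2]])
    qed
    from this[of n] have "enat n \<le> interval_length R M K (N n \<inter> L) + interval_length R M L (N n <+>\<^bsub>M\<^esub> L)"
      by simp
    also have "N n \<subseteq> T" using c by (auto simp: submodule_chain_def)
    then have "interval_length R M K (N n \<inter> L) + interval_length R M L (N n <+>\<^bsub>M\<^esub> L)
        \<le> interval_length R M K L + interval_length R M L T"
      using LT T by (intro add_mono interval_length_mono set_add_least) auto
    finally show "enat n \<le> interval_length R M K L + interval_length R M L T" .
  qed
  show "interval_length R M K L + interval_length R M L T \<le> interval_length R M K T"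
  proof (cases "interval_length R M L T")
    case infinity
    then show ?thesis using interval_length_mono[OF KL subset_refl, of R M T] by simp
  next
    case (enat n)
    then obtain N where c: "submodule_chain R M L T n N" using interval_length_attained[OF L LT] by blast
    have "interval_length R M K L + enat i \<le> interval_length R M K (N i)" if "i \<le> n" for i
      using that
    proof (induction i)
      case 0
      then have "L \<subseteq> N 0" using c by (auto simp: submodule_chain_def)
      then show ?case using interval_length_mono[of K K L "N 0"]
        by (simp add: zero_enat_def[symmetric])
    next
      case (Suc i)
      have "eSuc (interval_length R M K (N i)) \<le> interval_length R M K (N (Suc i))"
        using c Suc.prems unfolding submodule_chain_def
        by (intro interval_length_extend K subset_trans[OF KL]) auto
      moreover have "eSuc (interval_length R M K L + enat i) \<le> eSuc (interval_length R M K (N i))"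
        using Suc by simp
      ultimately show ?case
        unfolding eSuc_enat[symmetric] iadd_Suc_right by (rule order_trans[rotated])
    qed
    from this[of n] have "interval_length R M K L + enat n \<le> interval_length R M K (N n)" by simp
    also have "\<dots> \<le> interval_length R M K T" using c by (intro interval_length_mono) (auto simp: submodule_chain_def)
    finally show ?thesis using enat by simp
  qed
qed

end

section \<open>Linear maps and lengths\<close>

locale linear_map = module R M + N: module R N
  for R (structure) and M :: "('a, 'b, 'd) module_scheme" (structure)
    and N :: "('a, 'e, 'f) module_scheme" (structure) +
  fixes f :: "'b \<Rightarrow> 'e"
  assumes closed: "x \<in> carrier M \<Longrightarrow> f x \<in> carrier N"
    and add: "x \<in> carrier M \<Longrightarrow> y \<in> carrier M \<Longrightarrow> f (x \<oplus>\<^bsub>M\<^esub> y) = f x \<oplus>\<^bsub>N\<^esub> f y"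
    and smult: "r \<in> carrier R \<Longrightarrow> x \<in> carrier M \<Longrightarrow> f (r \<odot>\<^bsub>M\<^esub> x) = r \<odot>\<^bsub>N\<^esub> f x"
begin

lemma map_zero: "f \<zero>\<^bsub>M\<^esub> = \<zero>\<^bsub>N\<^esub>"
  using smult[of "\<zero>\<^bsub>R\<^esub>" "\<zero>\<^bsub>M\<^esub>"] by (simp add: closed)

lemma map_neg: "x \<in> carrier M \<Longrightarrow> f (\<ominus>\<^bsub>M\<^esub> x) = \<ominus>\<^bsub>N\<^esub> f x"
  using smult[of "\<ominus>\<^bsub>R\<^esub> \<one>\<^bsub>R\<^esub>" x] by (simp add: closed smult_l_minus N.smult_l_minus)

lemma map_diff: "x \<in> carrier M \<Longrightarrow> y \<in> carrier M \<Longrightarrow> f (x \<ominus>\<^bsub>M\<^esub> y) = f x \<ominus>\<^bsub>N\<^esub> f y"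
  by (simp add: a_minus_def add map_neg)

lemma preimage_submodule:
  assumes "submodule P R N"
  shows "submodule {x \<in> carrier M. f x \<in> P} R M"
  by (rule submoduleI) (simp_all add: map_zero map_neg add smult N.submodule_zero[OF assms]
      N.submodule_neg[OF assms] N.submodule_add[OF assms] N.submodule_smult[OF assms])

lemma image_submodule:
  assumes H: "submodule H R M"
  shows "submodule (f ` H) R N"
proof -
  note s = submodule_subset[OF H, THEN subsetD]
  show ?thesis
  proof (rule N.submoduleI)
    show "f ` H \<subseteq> carrier N" using s closed by blast
    show "\<zero>\<^bsub>N\<^esub> \<in> f ` H" using submodule_zero[OF H] map_zero by (metis imageI)
    fix a assume "a \<in> f ` H"
    then obtain x where x: "a = f x" "x \<in> H" by blast
    show "\<ominus>\<^bsub>N\<^esub> a \<in> f ` H" using x s submodule_neg[OF H] map_neg by (metis imageI)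
    show "r \<odot>\<^bsub>N\<^esub> a \<in> f ` H" if "r \<in> carrier R" for r
      using x s submodule_smult[OF H that] smult[OF that] by (metis imageI)
    fix b assume "b \<in> f ` H"
    then obtain y where y: "b = f y" "y \<in> H" by blast
    show "a \<oplus>\<^bsub>N\<^esub> b \<in> f ` H" using x y s submodule_add[OF H] add by (metis imageI)
  qed
qed

text \<open>Taking preimages and taking \<open>P + f(-)\<close> are mutually inverse on the submodules between \<open>P\<close> and \<open>Q\<close> and those
between their preimages, provided \<open>Q\<close> is reached by \<open>P\<close> and the image. This plays the part of the
isomorphism theorems without forming a quotient.\<close>

theorem interval_length_preimage:
  assumes P: "submodule P R N" and Q: "submodule Q R N" and PQ: "P \<subseteq> Q"
    and QP: "Q \<subseteq> P <+>\<^bsub>N\<^esub> f ` carrier M"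
  shows "interval_length R N P Q =
    interval_length R M {x \<in> carrier M. f x \<in> P} {x \<in> carrier M. f x \<in> Q}"
proof (rule antisym)
  let ?pre = "\<lambda>S. {x \<in> carrier M. f x \<in> S}"
  show "interval_length R N P Q \<le> interval_length R M (?pre P) (?pre Q)"
  proof (rule interval_length_map_le[where g = ?pre])
    fix A B assume AB: "submodule A R N" "submodule B R N" "P \<subseteq> A" "A \<subset> B" "B \<subseteq> Q"
    then obtain x where x: "x \<in> B" "x \<notin> A" by blast
    then obtain p y where py: "x = p \<oplus>\<^bsub>N\<^esub> f y" "p \<in> P" "y \<in> carrier M"
      using QP AB(5) by (auto simp: set_add_def')
    have c: "p \<in> carrier N" "f y \<in> carrier N" using py N.submodule_subset[OF P] closed by auto
    have "f y = x \<ominus>\<^bsub>N\<^esub> p" using py(1) c by (simp add: a_minus_def N.a_comm[of p] N.a_assoc N.r_neg)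
    then have "f y \<in> B" using N.submodule_diff[OF AB(2) x(1)] py(2) AB by auto
    moreover have "f y \<notin> A" using x py N.submodule_add[OF AB(1)] AB(3) by auto
    ultimately show "?pre A \<subset> ?pre B" using AB py(3) by blast
  qed (auto intro: preimage_submodule)
  show "interval_length R M (?pre P) (?pre Q) \<le> interval_length R N P Q"
  proof (rule interval_length_map_le[where g = "\<lambda>S. P <+>\<^bsub>N\<^esub> f ` S"], intro conjI)
    fix A assume A: "submodule A R M" "A \<subseteq> ?pre Q"
    note fA = image_submodule[OF A(1)]
    show "submodule (P <+>\<^bsub>N\<^esub> f ` A) R N" by (rule N.submodule_set_add[OF P fA])
    show "P \<subseteq> P <+>\<^bsub>N\<^esub> f ` A" by (rule N.set_add_subset_left[OF P fA])
    show "P <+>\<^bsub>N\<^esub> f ` A \<subseteq> Q" using A by (intro N.set_add_least[OF Q PQ]) auto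
  next
    fix A B assume AB: "submodule A R M" "submodule B R M" "?pre P \<subseteq> A" "A \<subset> B" "B \<subseteq> ?pre Q"
    then obtain b where b: "b \<in> B" "b \<notin> A" by blast
    have bM: "b \<in> carrier M" using b submodule_subset AB by auto
    have "f b \<in> P <+>\<^bsub>N\<^esub> f ` B"
      using b N.set_add_subset_right[OF P image_submodule[OF AB(2)]] by auto
    moreover have "f b \<notin> P <+>\<^bsub>N\<^esub> f ` A"
    proof
      assume "f b \<in> P <+>\<^bsub>N\<^esub> f ` A"
      then obtain p a where pa: "f b = p \<oplus>\<^bsub>N\<^esub> f a" "p \<in> P" "a \<in> A" by (auto simp: set_add_def')
      have aM: "a \<in> carrier M" using pa submodule_subset AB by auto
      have "p \<in> carrier N" using pa N.submodule_subset[OF P] by auto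
      then have "f (b \<ominus>\<^bsub>M\<^esub> a) = p"
        unfolding map_diff[OF bM aM] using pa(1) aM closed by (simp add: a_minus_def N.a_assoc N.r_neg)
      then have "b \<ominus>\<^bsub>M\<^esub> a \<in> A" using pa aM bM AB(3) by auto
      then have "(b \<ominus>\<^bsub>M\<^esub> a) \<oplus>\<^bsub>M\<^esub> a \<in> A" using submodule_add[OF AB(1)] pa by blast
      then show False using b aM bM by (simp add: a_minus_def a_assoc l_neg)
    qed
    moreover have "P <+>\<^bsub>N\<^esub> f ` A \<subseteq> P <+>\<^bsub>N\<^esub> f ` B" using AB(4) unfolding set_add_def' by blast
    ultimately show "P <+>\<^bsub>N\<^esub> f ` A \<subset> P <+>\<^bsub>N\<^esub> f ` B" by blast
  qed
qed

end


lemma (in module) submoduleI_smult: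
  assumes H: "H \<subseteq> carrier M" and 0: "\<zero>\<^bsub>M\<^esub> \<in> H"
    and add: "\<And>a b. a \<in> H \<Longrightarrow> b \<in> H \<Longrightarrow> a \<oplus>\<^bsub>M\<^esub> b \<in> H"
    and smult: "\<And>r x. r \<in> carrier R \<Longrightarrow> x \<in> H \<Longrightarrow> r \<odot>\<^bsub>M\<^esub> x \<in> H"
  shows "submodule H R M"
proof (rule submoduleI[OF H 0 _ add smult])
  fix a assume a: "a \<in> H"
  then have "(\<ominus>\<^bsub>R\<^esub> \<one>\<^bsub>R\<^esub>) \<odot>\<^bsub>M\<^esub> a = \<ominus>\<^bsub>M\<^esub> a" using H smult_l_minus[of "\<one>\<^bsub>R\<^esub>" a] by auto
  then show "\<ominus>\<^bsub>M\<^esub> a \<in> H" using smult[OF _ a, of "\<ominus>\<^bsub>R\<^esub> \<one>\<^bsub>R\<^esub>"] by simp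
qed

lemma (in module) submodule_sub_iff:
  assumes L: "submodule L R M"
  shows "submodule N R (M\<lparr>carrier := L\<rparr>) \<longleftrightarrow> submodule N R M \<and> N \<subseteq> L"
proof -
  interpret S: module R "M\<lparr>carrier := L\<rparr>"
    using submodule.submodule_is_module[OF L] module_axioms by blast
  show ?thesis
  proof (intro iffI conjI)
    assume N: "submodule N R (M\<lparr>carrier := L\<rparr>)"
    show NL: "N \<subseteq> L" using S.submodule_subset[OF N] by simp
    show "submodule N R M"
      using NL submodule_subset[OF L] S.submodule_zero[OF N] S.submodule_add[OF N] S.submodule_smult[OF N]
      by (intro submoduleI_smult) auto
  next
    assume N: "submodule N R M \<and> N \<subseteq> L"
    then show "submodule N R (M\<lparr>carrier := L\<rparr>)"
      using submodule_zero submodule_add submodule_smult by (intro S.submoduleI_smult) auto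
  qed
qed

lemma (in module) interval_length_sub:
  assumes L: "submodule L R M" and "T \<subseteq> L"
  shows "interval_length R (M\<lparr>carrier := L\<rparr>) K T = interval_length R M K T"
  using assms(2) by (intro antisym; intro interval_length_map_le[where g = "\<lambda>N. N"])
    (auto simp: submodule_sub_iff[OF L])

text \<open>The same with \<open>f\<close> restricted to a submodule \<open>L\<close>; the filtration argument for direct sums needs this version.\<close>

theorem (in linear_map) interval_length_preimage_on:
  assumes L: "submodule L R M" and P: "submodule P R N" and Q: "submodule Q R N" and PQ: "P \<subseteq> Q"
    and QP: "Q \<subseteq> P <+>\<^bsub>N\<^esub> f ` L"
  shows "interval_length R N P Q = interval_length R M {x \<in> L. f x \<in> P} {x \<in> L. f x \<in> Q}"
proof -
  have "module R (M\<lparr>carrier := L\<rparr>)"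
    using submodule.submodule_is_module[OF L] module_axioms by blast
  then interpret S: linear_map R "M\<lparr>carrier := L\<rparr>" N f
    using submodule_subset[OF L, THEN subsetD]
    by (intro linear_map.intro linear_map_axioms.intro) (auto simp: N.module_axioms closed add smult)
  have "interval_length R N P Q =
      interval_length R (M\<lparr>carrier := L\<rparr>) {x \<in> L. f x \<in> P} {x \<in> L. f x \<in> Q}"
    using S.interval_length_preimage[OF P Q PQ] QP by simp
  also have "\<dots> = interval_length R M {x \<in> L. f x \<in> P} {x \<in> L. f x \<in> Q}"
    by (rule interval_length_sub[OF L]) auto
  finally show ?thesis .
qed

text \<open>The module axioms are identities, so they pass to any image under an operation-preserving surjection. This
spares a separate verification for quotient modules, whose operations are unions of cosets.\<close>

lemma (in module) linear_map_surjI: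
  fixes N :: "('a, 'e, 'f) module_scheme" and f :: "'c \<Rightarrow> 'e"
  assumes surj: "f ` carrier M = carrier N" and zero: "f \<zero>\<^bsub>M\<^esub> = \<zero>\<^bsub>N\<^esub>"
    and add: "\<And>x y. x \<in> carrier M \<Longrightarrow> y \<in> carrier M \<Longrightarrow> f (x \<oplus>\<^bsub>M\<^esub> y) = f x \<oplus>\<^bsub>N\<^esub> f y"
    and smult: "\<And>r x. r \<in> carrier R \<Longrightarrow> x \<in> carrier M \<Longrightarrow> f (r \<odot>\<^bsub>M\<^esub> x) = r \<odot>\<^bsub>N\<^esub> f x"
  shows "linear_map R M N f"
proof -
  have ex: "\<exists>x\<in>carrier M. y = f x" if "y \<in> carrier N" for y using surj that by blast
  have cl: "f x \<in> carrier N" if "x \<in> carrier M" for x using surj that by blast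
  have "abelian_group N"
  proof (rule abelian_groupI)
    show "\<zero>\<^bsub>N\<^esub> \<in> carrier N" using cl zero by (metis M.zero_closed)
    show "x \<oplus>\<^bsub>N\<^esub> y \<in> carrier N" if "x \<in> carrier N" "y \<in> carrier N" for x y
      using ex[OF that(1)] ex[OF that(2)] by (auto simp: cl add[symmetric])
    show "x \<oplus>\<^bsub>N\<^esub> y = y \<oplus>\<^bsub>N\<^esub> x" if "x \<in> carrier N" "y \<in> carrier N" for x y
      using ex[OF that(1)] ex[OF that(2)] by (auto simp: add[symmetric] M.a_comm)
    show "x \<oplus>\<^bsub>N\<^esub> y \<oplus>\<^bsub>N\<^esub> z = x \<oplus>\<^bsub>N\<^esub> (y \<oplus>\<^bsub>N\<^esub> z)"
      if "x \<in> carrier N" "y \<in> carrier N" "z \<in> carrier N" for x y z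
      using ex[OF that(1)] ex[OF that(2)] ex[OF that(3)] by (auto simp: add[symmetric] M.a_assoc)
    fix x assume "x \<in> carrier N"
    then obtain a where a: "a \<in> carrier M" "x = f a" using ex by meson
    show "\<zero>\<^bsub>N\<^esub> \<oplus>\<^bsub>N\<^esub> x = x" using a by (simp add: add[symmetric] zero[symmetric])
    have "f (\<ominus>\<^bsub>M\<^esub> a) \<oplus>\<^bsub>N\<^esub> x = \<zero>\<^bsub>N\<^esub>" using a by (simp add: add[symmetric] zero[symmetric] M.l_neg)
    then show "\<exists>y\<in>carrier N. y \<oplus>\<^bsub>N\<^esub> x = \<zero>\<^bsub>N\<^esub>" using a cl by blast
  qed
  then have "module R N"
  proof (rule moduleI[OF R.is_cring])
    fix r x assume r: "r \<in> carrier R" and "x \<in> carrier N"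
    then obtain a where a: "a \<in> carrier M" "x = f a" using ex by meson
    show "r \<odot>\<^bsub>N\<^esub> x \<in> carrier N" using r a by (simp add: smult[symmetric] cl)
    show "(r \<oplus>\<^bsub>R\<^esub> s) \<odot>\<^bsub>N\<^esub> x = r \<odot>\<^bsub>N\<^esub> x \<oplus>\<^bsub>N\<^esub> s \<odot>\<^bsub>N\<^esub> x"
        "r \<otimes>\<^bsub>R\<^esub> s \<odot>\<^bsub>N\<^esub> x = r \<odot>\<^bsub>N\<^esub> (s \<odot>\<^bsub>N\<^esub> x)" if "s \<in> carrier R" for s
      using r a that by (simp_all add: add[symmetric] smult[symmetric] smult_l_distr smult_assoc1)
    show "r \<odot>\<^bsub>N\<^esub> (x \<oplus>\<^bsub>N\<^esub> y) = r \<odot>\<^bsub>N\<^esub> x \<oplus>\<^bsub>N\<^esub> r \<odot>\<^bsub>N\<^esub> y" if "y \<in> carrier N" for y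
      using ex[OF that] r a by (auto simp: add[symmetric] smult[symmetric] smult_r_distr)
  next
    show "\<one>\<^bsub>R\<^esub> \<odot>\<^bsub>N\<^esub> x = x" if "x \<in> carrier N" for x
      using ex[OF that] by (auto simp: smult[symmetric])
  qed
  then show ?thesis
    by (intro linear_map.intro linear_map_axioms.intro module_axioms cl add smult)
qed

section \<open>Lengths of quotients and subquotients\<close>

lemma module_length_interval:
  assumes "module R Q"
  shows "module_length R Q = interval_length R Q {\<zero>\<^bsub>Q\<^esub>} (carrier Q)"
proof -
  have "submodule H R Q \<and> {\<zero>\<^bsub>Q\<^esub>} \<subseteq> H \<and> H \<subseteq> carrier Q \<longleftrightarrow> submodule H R Q" for H
    using module.submodule_subset[OF assms, of H] module.submodule_zero[OF assms, of H] by auto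
  then show ?thesis by (simp only: module_length_def interval_length_def submodule_chain_def)
qed

context
  fixes R :: "('a, 'c) ring_scheme" and M :: "('a, 'b) module" and F :: "'b set"
  assumes M: "module R M" and F: "submodule F R M"
begin

interpretation module R M by (rule M)

lemma submodule_abelian_subgroup: "abelian_subgroup F M"
  using F by (intro abelian_subgroupI3 additive_subgroup.intro M.abelian_group_axioms)
    (auto simp: submodule_def)

interpretation F: abelian_subgroup F M by (rule submodule_abelian_subgroup)

lemma coset_eq_iff:
  assumes "x \<in> carrier M" "y \<in> carrier M"
  shows "F +>\<^bsub>M\<^esub> x = F +>\<^bsub>M\<^esub> y \<longleftrightarrow> x \<ominus>\<^bsub>M\<^esub> y \<in> F"
proof -
  have "x \<in> F +>\<^bsub>M\<^esub> y \<longleftrightarrow> x \<ominus>\<^bsub>M\<^esub> y \<in> F"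
    using F.a_rcos_module[OF assms(2,1)] by (simp only: a_minus_def)
  then show ?thesis
    using F.a_repr_independence'[OF _ assms(2), of x] F.a_rcos_self[OF assms(1)] by metis
qed

lemma quotient_linear_map: "linear_map R M (quot_module M F) (\<lambda>x. F +>\<^bsub>M\<^esub> x)"
proof (rule linear_map_surjI)
  show "(\<lambda>x. F +>\<^bsub>M\<^esub> x) ` carrier M = carrier (quot_module M F)"
    by (auto simp: quot_module_def A_RCOSETS_def')
  show "F +>\<^bsub>M\<^esub> \<zero>\<^bsub>M\<^esub> = \<zero>\<^bsub>quot_module M F\<^esub>"
    using submodule_subset[OF F] by (simp add: quot_module_def)
  show "F +>\<^bsub>M\<^esub> (x \<oplus>\<^bsub>M\<^esub> y) = (F +>\<^bsub>M\<^esub> x) \<oplus>\<^bsub>quot_module M F\<^esub> (F +>\<^bsub>M\<^esub> y)"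
    if "x \<in> carrier M" "y \<in> carrier M" for x y
    using that by (simp add: quot_module_def F.a_rcos_sum)
  fix r x assume rx: "r \<in> carrier R" "x \<in> carrier M"
  have "F +>\<^bsub>M\<^esub> (r \<odot>\<^bsub>M\<^esub> u) = F +>\<^bsub>M\<^esub> (r \<odot>\<^bsub>M\<^esub> x)" if "u \<in> F +>\<^bsub>M\<^esub> x" for u
  proof -
    obtain k where k: "k \<in> F" "u = k \<oplus>\<^bsub>M\<^esub> x" using \<open>u \<in> F +>\<^bsub>M\<^esub> x\<close> by (auto simp: a_r_coset_def')
    have "k \<in> carrier M" using k submodule_subset[OF F] by auto
    then have "r \<odot>\<^bsub>M\<^esub> u = r \<odot>\<^bsub>M\<^esub> k \<oplus>\<^bsub>M\<^esub> r \<odot>\<^bsub>M\<^esub> x" using k rx by (simp add: smult_r_distr)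
    moreover have "r \<odot>\<^bsub>M\<^esub> k \<in> F" using submodule_smult[OF F rx(1) k(1)] .
    ultimately have "r \<odot>\<^bsub>M\<^esub> u \<in> F +>\<^bsub>M\<^esub> (r \<odot>\<^bsub>M\<^esub> x)" by (auto simp: a_r_coset_def')
    then show ?thesis by (rule F.a_repr_independence'[symmetric]) (simp add: rx)
  qed
  moreover have "x \<in> F +>\<^bsub>M\<^esub> x" using rx by (simp add: F.a_rcos_self)
  ultimately show "F +>\<^bsub>M\<^esub> (r \<odot>\<^bsub>M\<^esub> x) = r \<odot>\<^bsub>quot_module M F\<^esub> (F +>\<^bsub>M\<^esub> x)"
    unfolding quot_module_def module.simps by blast
qed

interpretation Q: linear_map R M "quot_module M F" "\<lambda>x. F +>\<^bsub>M\<^esub> x" by (rule quotient_linear_map)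

lemma quotient_preimage_image:
  assumes B: "submodule B R M" and FB: "F \<subseteq> B"
  shows "{x \<in> carrier M. F +>\<^bsub>M\<^esub> x \<in> (\<lambda>x. F +>\<^bsub>M\<^esub> x) ` B} = B"
proof -
  have "x \<in> B" if x: "x \<in> carrier M" and b: "b \<in> B" "F +>\<^bsub>M\<^esub> x = F +>\<^bsub>M\<^esub> b" for x b
  proof -
    have bM: "b \<in> carrier M" using b submodule_subset[OF B] by auto
    have "x \<ominus>\<^bsub>M\<^esub> b \<in> B" using coset_eq_iff[OF x bM] b FB by auto
    then have "(x \<ominus>\<^bsub>M\<^esub> b) \<oplus>\<^bsub>M\<^esub> b \<in> B" using submodule_add[OF B] b by auto
    then show ?thesis using x bM by (simp add: a_minus_def M.a_assoc M.l_neg)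
  qed
  then show ?thesis using submodule_subset[OF B] by blast
qed

lemma interval_length_quotient:
  assumes B: "submodule B R M" and Z: "submodule Z R M" and "F \<subseteq> B" "B \<subseteq> Z"
  shows "interval_length R (quot_module M F) ((\<lambda>x. F +>\<^bsub>M\<^esub> x) ` B) ((\<lambda>x. F +>\<^bsub>M\<^esub> x) ` Z)
    = interval_length R M B Z"
proof -
  let ?p = "\<lambda>x. F +>\<^bsub>M\<^esub> x"
  have "?p ` Z \<subseteq> ?p ` carrier M" using submodule_subset[OF Z] by blast
  also have "\<dots> \<subseteq> ?p ` B <+>\<^bsub>quot_module M F\<^esub> ?p ` carrier M"
    by (rule Q.N.set_add_subset_right[OF Q.image_submodule[OF B] Q.image_submodule[OF carrier_is_submodule]])
  finally show ?thesis
    using Q.interval_length_preimage[OF Q.image_submodule[OF B] Q.image_submodule[OF Z]] assms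
    by (simp add: quotient_preimage_image image_mono)
qed

end

text \<open>The bridge from the record-based quotient \<open>L / K\<close> to intervals of submodules of \<open>M\<close>.\<close>

theorem module_length_subquotient:
  fixes M :: "('a, 'b) module"
  assumes M: "module R M" and K: "submodule K R M" and L: "submodule L R M" and KL: "K \<subseteq> L"
  shows "module_length R (quot_module (sub_module M L) K) = interval_length R M K L"
proof -
  interpret module R M by (rule M)
  let ?S = "sub_module M L"
  have S: "module R ?S" using submodule.submodule_is_module[OF L] M by blast
  interpret S: module R ?S by (rule S)
  have KS: "submodule K R ?S" using K KL by (simp add: submodule_sub_iff[OF L])
  interpret q: linear_map R ?S "quot_module ?S K" "\<lambda>x. K +>\<^bsub>?S\<^esub> x"
    by (rule quotient_linear_map[OF S KS])
  have "(\<lambda>x. K +>\<^bsub>?S\<^esub> x) ` K = {K}"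
    using S.submodule_zero[OF KS] abelian_subgroup.a_rcos_const[OF submodule_abelian_subgroup[OF S KS]]
    by (auto simp: image_iff)
  moreover have "(\<lambda>x. K +>\<^bsub>?S\<^esub> x) ` L = carrier (quot_module ?S K)"
    by (auto simp: quot_module_def A_RCOSETS_def')
  ultimately have "module_length R (quot_module ?S K) = interval_length R ?S K L"
    using interval_length_quotient[OF S KS KS S.carrier_is_submodule] KL module_length_interval[OF q.N.module_axioms]
    by (simp add: quot_module_def)
  then show ?thesis using interval_length_sub[OF L, of L K] by simp
qed

text \<open>The form in which homology of a quotient complex occurs: a subquotient of \<open>M / F\<close>, both of whose ends are
images of submodules of \<open>M\<close> containing \<open>F\<close>, has the length of the corresponding interval of \<open>M\<close>.\<close>

corollary module_length_subquotient_of_quotient: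
  fixes M :: "('a, 'b) module"
  assumes M: "module R M" and F: "submodule F R M" and B: "submodule B R M" and Z: "submodule Z R M"
    and "F \<subseteq> B" "B \<subseteq> Z"
  shows "module_length R (quot_module (sub_module (quot_module M F) ((\<lambda>x. F +>\<^bsub>M\<^esub> x) ` Z))
      ((\<lambda>x. F +>\<^bsub>M\<^esub> x) ` B)) = interval_length R M B Z"
proof -
  interpret q: linear_map R M "quot_module M F" "\<lambda>x. F +>\<^bsub>M\<^esub> x" by (rule quotient_linear_map[OF M F])
  show ?thesis
    using module_length_subquotient[OF q.N.module_axioms q.image_submodule[OF B] q.image_submodule[OF Z]]
      interval_length_quotient[OF M F B Z] assms by (simp add: image_mono)
qed

lemma (in cring) self_module: "module R (self_module R)"
proof -
  have "abelian_group (self_module R)"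
    by (rule abelian_groupI) (auto simp: self_module_def a_ac intro: bexI[of _ "\<ominus> _"] l_neg)
  then show ?thesis
    by (intro moduleI is_cring) (auto simp: self_module_def l_distr r_distr m_assoc)
qed

lemma (in cring) submodule_self_iff: "submodule J R (self_module R) \<longleftrightarrow> ideal J R"
proof -
  interpret S: module R "self_module R" by (rule self_module)
  show ?thesis
  proof
    assume J: "submodule J R (self_module R)"
    have JR: "J \<subseteq> carrier R" using S.submodule_subset[OF J] by (simp add: self_module_def)
    have "\<ominus> a \<in> J" if a: "a \<in> J" for a
      using S.submodule_smult[OF J _ a, of "\<ominus> \<one>"] subsetD[OF JR a] by (simp add: self_module_def l_minus)
    then have "subgroup J (add_monoid R)"
      using JR S.submodule_add[OF J] S.submodule_zero[OF J]
      by (intro add.subgroupI) (auto simp: self_module_def)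
    then show "ideal J R"
    proof (rule idealI[OF ring_axioms])
      fix a x assume a: "a \<in> J" and x: "x \<in> carrier R"
      show "x \<otimes> a \<in> J" using S.submodule_smult[OF J x a] by (simp add: self_module_def)
      then show "a \<otimes> x \<in> J" using m_comm x subsetD[OF JR a] by simp
    qed
  next
    assume "ideal J R"
    then interpret J: ideal J R .
    show "submodule J R (self_module R)"
      by (rule S.submoduleI_smult) (auto simp: self_module_def J.I_l_closed)
  qed
qed

lemma (in cring) module_length_ideal_quot:
  assumes "ideal K R" "ideal J R" "K \<subseteq> J"
  shows "module_length R (ideal_quot R J K) = interval_length R (self_module R) K J"
  unfolding ideal_quot_def
  using assms by (intro module_length_subquotient self_module) (auto simp: submodule_self_iff)


section \<open>Ideals of finite colength in a Noetherian ring\<close>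

lemma (in noetherian_ring) maximal_among_ideals:
  assumes "S \<noteq> {}" and "S \<subseteq> {J. ideal J R}"
  shows "\<exists>J\<in>S. \<forall>J'\<in>S. J \<subseteq> J' \<longrightarrow> J' = J"
proof (rule subset_Zorn_nonempty[OF assms(1)])
  fix C assume C: "C \<noteq> {}" "subset.chain S C"
  then have "subset.chain {J. ideal J R} C" using assms(2) by (auto simp: subset_chain_def)
  then have "\<Union>C \<in> C" using ideal_chain_is_trivial C(1) by blast
  then show "\<Union>C \<in> S" using C(2) by (auto simp: subset_chain_def)
qed

definition colon :: "('a, 'c) ring_scheme \<Rightarrow> 'a set \<Rightarrow> 'a \<Rightarrow> 'a set" where
  "colon R J a = {r \<in> carrier R. r \<otimes>\<^bsub>R\<^esub> a \<in> J}"

lemma (in cring) colon_ideal: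
  assumes "ideal J R" and a: "a \<in> carrier R"
  shows "ideal (colon R J a) R"
proof -
  interpret J: ideal J R by fact
  have neg: "\<ominus> x \<otimes> a \<in> J" if "x \<in> carrier R" "x \<otimes> a \<in> J" for x
    using that a J.a_inv_closed[of "x \<otimes> a"] by (simp add: l_minus)
  show ?thesis
  proof (rule idealI[OF ring_axioms])
    show "subgroup (colon R J a) (add_monoid R)"
      using neg a by (intro add.subgroupI) (auto simp: colon_def l_distr intro!: exI[of _ \<zero>])
    fix x r assume x: "x \<in> colon R J a" and r: "r \<in> carrier R"
    then have "r \<otimes> (x \<otimes> a) \<in> J" by (simp add: colon_def J.I_l_closed)
    then show "r \<otimes> x \<in> colon R J a" using x r a by (simp add: colon_def m_assoc)
    then show "x \<otimes> r \<in> colon R J a" using x r by (simp add: colon_def m_comm)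
  qed
qed

text \<open>Choose \<open>a \<notin> J\<close> with
\<open>(J : a)\<close> maximal among all such colon ideals. For \<open>r \<in> m\<close> the last power \<open>r\<^sup>l a\<close> outside \<open>J\<close> has a colon ideal
that contains both \<open>(J : a)\<close> and \<open>r\<close>, so by maximality \<open>r \<in> (J : a)\<close>.\<close>

lemma (in cring) socle_element:
  assumes noeth: "noetherian_ring R" and J: "ideal J R" and ne: "J \<noteq> carrier R"
    and m: "m \<subseteq> radical R J"
  shows "\<exists>a\<in>carrier R. a \<notin> J \<and> m \<subseteq> colon R J a"
proof -
  interpret noetherian_ring R by (rule noeth)
  let ?S = "colon R J ` (carrier R - J)"
  have "?S \<noteq> {}" using ideal.axioms(1)[OF J, THEN additive_subgroup.a_subset] ne by auto
  moreover have "?S \<subseteq> {J. ideal J R}" using colon_ideal[OF J] by auto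
  ultimately have "\<exists>K\<in>?S. \<forall>K'\<in>?S. K \<subseteq> K' \<longrightarrow> K' = K" by (rule maximal_among_ideals)
  then obtain a where a: "a \<in> carrier R" "a \<notin> J"
    and max: "\<And>b. b \<in> carrier R \<Longrightarrow> b \<notin> J \<Longrightarrow> colon R J a \<subseteq> colon R J b \<Longrightarrow> colon R J b = colon R J a"
    unfolding bex_simps ball_simps by blast
  have "r \<in> colon R J a" if r: "r \<in> m" for r
  proof -
    obtain n :: nat where rR: "r \<in> carrier R" and n: "r [^] n \<in> J" using m r by (auto simp: radical_def)
    define k where "k = (LEAST k::nat. r [^] k \<otimes> a \<in> J)"
    have ex: "r [^] n \<otimes> a \<in> J" using n a ideal.I_r_closed[OF J] by blast
    then have k: "r [^] k \<otimes> a \<in> J" unfolding k_def by (rule LeastI)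
    then have "k \<noteq> 0" using a by (auto intro: ccontr)
    then obtain l where l: "k = Suc l" by (cases k) auto
    let ?b = "r [^] l \<otimes> a"
    have b: "?b \<notin> J" using not_less_Least[of l "\<lambda>k. r [^] k \<otimes> a \<in> J"] l by (simp add: k_def)
    have bR: "?b \<in> carrier R" using rR a by simp
    have "colon R J a \<subseteq> colon R J ?b"
    proof
      fix s assume s: "s \<in> colon R J a"
      then have "r [^] l \<otimes> (s \<otimes> a) \<in> J" using rR ideal.I_l_closed[OF J] by (simp add: colon_def)
      then show "s \<in> colon R J ?b" using s rR a by (simp add: colon_def m_lcomm)
    qed
    moreover have "r \<in> colon R J ?b"
      using k l rR a by (simp add: colon_def m_assoc[symmetric] m_comm[of r])
    ultimately show ?thesis using max[OF bR b] by simp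
  qed
  then show ?thesis using a by auto
qed

text \<open>\<open>(J + R a) / J\<close> is a cyclic module over the field \<open>R / m\<close>: if an ideal above \<open>J\<close> contains \<open>j + r a \<notin> J\<close>, then \<open>r \<notin> m\<close>
is invertible modulo \<open>m\<close>, and the ideal contains \<open>a\<close>.\<close>

lemma (in cring) interval_length_simple_step:
  assumes J: "ideal J R" and m: "maximalideal m R" and a: "a \<in> carrier R" and ma: "m \<subseteq> colon R J a"
  shows "interval_length R (self_module R) J (J <+>\<^bsub>R\<^esub> PIdl a) \<le> 1"
proof -
  interpret J: ideal J R by (rule J)
  interpret m: maximalideal m R by (rule m)
  have eq: "N = J <+>\<^bsub>R\<^esub> PIdl a" if N: "ideal N R" and JN: "J \<subset> N" "N \<subseteq> J <+>\<^bsub>R\<^esub> PIdl a" for N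
  proof -
    interpret N: ideal N R by (rule N)
    obtain x where x: "x \<in> N" "x \<notin> J" using JN by blast
    then obtain j r where jr: "x = j \<oplus> r \<otimes> a" "j \<in> J" "r \<in> carrier R"
      using JN(2) by (auto simp: set_add_def' cgenideal_def)
    have "r \<notin> m" using x jr ma by (auto simp: colon_def)
    let ?M = "m <+>\<^bsub>R\<^esub> PIdl r"
    have "ideal ?M R" using m.is_ideal cgenideal_ideal[OF jr(3)] by (rule add_ideals)
    moreover have "m \<subseteq> ?M"
    proof
      fix y assume y: "y \<in> m"
      then have "y \<oplus> \<zero> \<otimes> r \<in> ?M" by (auto simp: set_add_def' cgenideal_def)
      then show "y \<in> ?M" using y jr m.a_subset by auto
    qed
    moreover have "r \<in> ?M"
    proof -
      have "\<zero> \<oplus> \<one> \<otimes> r \<in> ?M" using m.zero_closed by (force simp: set_add_def' cgenideal_def)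
      then show ?thesis using jr by simp
    qed
    ultimately have "?M = carrier R"
      using m.I_maximal[of ?M] \<open>r \<notin> m\<close> ideal.axioms(1)[THEN additive_subgroup.a_subset] by metis
    then have "\<one> \<in> ?M" by simp
    then obtain u s where us: "\<one> = u \<oplus> s \<otimes> r" "u \<in> m" "s \<in> carrier R"
      by (auto simp: set_add_def' cgenideal_def)
    have uR: "u \<in> carrier R" using us m.a_subset by auto
    have "j \<in> carrier R" using jr by auto
    then have "r \<otimes> a = x \<oplus> \<ominus> j"
      using jr a by (simp add: a_comm[of j] a_assoc r_neg)
    then have ra: "r \<otimes> a \<in> N" using x jr(2) JN(1) N.a_closed N.a_inv_closed by auto
    have "a = (u \<oplus> s \<otimes> r) \<otimes> a" using a by (simp add: us(1)[symmetric])
    also have "\<dots> = u \<otimes> a \<oplus> s \<otimes> (r \<otimes> a)" using us(2,3) uR jr(3) a by (simp add: l_distr m_assoc)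
    also have "\<dots> \<in> N" using us ma JN(1) N.I_l_closed[OF ra us(3)] by (auto simp: colon_def)
    finally have "a \<in> N" .
    then have "PIdl a \<subseteq> N" using N.I_l_closed by (auto simp: cgenideal_def)
    then have "J <+>\<^bsub>R\<^esub> PIdl a \<subseteq> N" using JN(1) by (auto simp: set_add_def')
    then show ?thesis using JN by auto
  qed
  show ?thesis
  proof (rule interval_length_le)
    fix n N assume c: "submodule_chain R (self_module R) J (J <+>\<^bsub>R\<^esub> PIdl a) n N"
    have "n \<le> 1"
    proof (rule ccontr)
      assume "\<not> n \<le> 1"
      then have n: "0 < n" "Suc 0 < n" by auto
      have N: "ideal (N i) R" "J \<subseteq> N i" "N i \<subseteq> J <+>\<^bsub>R\<^esub> PIdl a" if "i \<le> n" for i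
        using c that by (auto simp: submodule_chain_def submodule_self_iff)
      have "N 0 \<subset> N (Suc 0)" "N (Suc 0) \<subset> N (Suc (Suc 0))" using c n by (auto simp: submodule_chain_def)
      moreover have "N (Suc 0) = J <+>\<^bsub>R\<^esub> PIdl a" using N[of 0] N[of "Suc 0"] n calculation by (intro eq) auto
      ultimately show False using N[of "Suc (Suc 0)"] n by auto
    qed
    then show "enat n \<le> 1" by (simp add: one_enat_def)
  qed
qed

text \<open>Noetherian induction: an ideal of infinite colength that is maximal among those with \<open>m\<close> in the radical can
be enlarged by a simple step to one of finite colength, and length is additive.\<close>

theorem (in cring) finite_colength:
  assumes noeth: "noetherian_ring R" and m: "maximalideal m R"
    and J: "ideal J R" and mJ: "m \<subseteq> radical R J"
  shows "interval_length R (self_module R) J (carrier R) \<noteq> \<infinity>"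
proof (rule ccontr)
  interpret S: module R "self_module R" by (rule self_module)
  interpret noetherian_ring R by (rule noeth)
  let ?l = "\<lambda>J. interval_length R (self_module R) J (carrier R)"
  let ?S = "{J. ideal J R \<and> m \<subseteq> radical R J \<and> ?l J = \<infinity>}"
  assume "\<not> ?l J \<noteq> \<infinity>"
  then have "?S \<noteq> {}" using J mJ by auto
  moreover have "?S \<subseteq> {J. ideal J R}" by auto
  ultimately have "\<exists>A\<in>?S. \<forall>B\<in>?S. A \<subseteq> B \<longrightarrow> B = A" by (rule maximal_among_ideals)
  then obtain A where AS: "A \<in> ?S" and maxS: "\<forall>B\<in>?S. A \<subseteq> B \<longrightarrow> B = A" by (rule bexE)
  from AS have A: "ideal A R" "m \<subseteq> radical R A" "?l A = \<infinity>" by simp_all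
  have max: "B = A" if "ideal B R" "m \<subseteq> radical R B" "?l B = \<infinity>" "A \<subseteq> B" for B
    using maxS that by simp
  have "A \<noteq> carrier R" using A(3) interval_length_refl[of R "self_module R" A] by auto
  then obtain a where a: "a \<in> carrier R" "a \<notin> A" "m \<subseteq> colon R A a"
    using socle_element[OF noeth A(1) _ A(2)] by blast
  let ?B = "A <+>\<^bsub>R\<^esub> PIdl a"
  have B: "ideal ?B R" using A(1) cgenideal_ideal[OF a(1)] by (rule add_ideals)
  have sub: "submodule A R (self_module R)" "submodule (PIdl a) R (self_module R)"
    using A(1) cgenideal_ideal[OF a(1)] by (auto simp: submodule_self_iff)
  have "set_add (self_module R) = set_add R"
    by (intro ext) (simp add: set_add_def' self_module_def)
  then have AB: "A \<subseteq> ?B" and aB: "PIdl a \<subseteq> ?B"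
    using S.set_add_subset_left[OF sub] S.set_add_subset_right[OF sub] by auto
  have "a \<in> ?B" using aB cgenideal_self[OF a(1)] by auto
  then have "?B \<noteq> A" using a by auto
  moreover have "m \<subseteq> radical R ?B" using A(2) AB by (auto simp: radical_def)
  ultimately have fin: "?l ?B \<noteq> \<infinity>" using max[OF B] AB by auto
  have "?l A = interval_length R (self_module R) A ?B + ?l ?B"
    using AB B sub ideal.axioms(1)[OF B, THEN additive_subgroup.a_subset]
    by (intro S.interval_length_additive) (auto simp: submodule_self_iff oneideal)
  moreover have "interval_length R (self_module R) A ?B \<noteq> \<infinity>"
    using interval_length_simple_step[OF A(1) m a(1,3)] by (metis enat_ord_simps(5) enat_ord_code(5) infinity_ne_i1)
  ultimately show False using A(3) fin by (metis plus_eq_infty_iff_enat)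
qed

section \<open>Powers of ideals\<close>

context cring begin

interpretation Is: comm_monoid "ideals_set R" by (rule ideals_set_is_comm_monoid)

lemma ideal_nat_pow: "ideal I R \<Longrightarrow> ideal (I [^]\<^bsub>ideals_set R\<^esub> (n::nat)) R"
  using Is.nat_pow_closed[of I n] by (simp add: ideals_set_def)

lemma ideal_pow_ideal: "ideal I R \<Longrightarrow> ideal (ideal_pow R I n) R"
  unfolding ideal_pow_def by (rule ideal_nat_pow)

lemma bipow_ideal: "ideal I1 R \<Longrightarrow> ideal I2 R \<Longrightarrow> ideal (bipow R I1 I2 n1 n2) R"
  unfolding bipow_def by (intro ideal_prod_is_ideal ideal_pow_ideal)

lemma bipow_commute: "ideal I1 R \<Longrightarrow> ideal I2 R \<Longrightarrow> bipow R I1 I2 n1 n2 = bipow R I2 I1 n2 n1"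
  unfolding bipow_def by (intro ideal_prod_commute ideal_pow_ideal)

text \<open>This holds for every integer \<open>n\<close>: for \<open>n \<le> 0\<close> the power is the whole ring. The Koszul complex needs it in that range as well,
since its components involve \<open>n1 - card A\<close> and \<open>n2 - card B\<close>, which may be negative.\<close>

lemma ideal_pow_mult:
  assumes I: "ideal I R" and x: "x \<in> I" and y: "y \<in> ideal_pow R I (n - 1)"
  shows "x \<otimes> y \<in> ideal_pow R I n"
proof (cases "n \<ge> 1")
  case True
  then have "nat n = Suc (nat (n - 1))" by simp
  then have "ideal_pow R I n = ideal_pow R I (n - 1) \<cdot> I"
    unfolding ideal_pow_def by (simp add: ideals_set_def)
  moreover have "y \<otimes> x \<in> ideal_pow R I (n - 1) \<cdot> I" by (rule ideal_prod.prod[OF y x])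
  moreover have "x \<in> carrier R" "y \<in> carrier R"
    using x y ideal.Icarr[OF I] ideal.Icarr[OF ideal_pow_ideal[OF I]] by auto
  ultimately show ?thesis by (simp add: m_comm)
next
  case False
  then have "ideal_pow R I n = carrier R" by (simp add: ideal_pow_def ideals_set_def)
  then show ?thesis using x y ideal.Icarr[OF I] ideal.Icarr[OF ideal_pow_ideal[OF I]] by auto
qed

lemma bipow_mult_left:
  assumes I: "ideal I1 R" "ideal I2 R" and x: "x \<in> I1" and y: "y \<in> bipow R I1 I2 (n1 - 1) n2"
  shows "x \<otimes> y \<in> bipow R I1 I2 n1 n2"
proof -
  have xR: "x \<in> carrier R" using x ideal.Icarr[OF I(1)] by auto
  show ?thesis
    using y unfolding bipow_def
  proof (induction y rule: ideal_prod.induct)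
    case (prod i j)
    then have "i \<in> carrier R" "j \<in> carrier R"
      using ideal.Icarr[OF ideal_pow_ideal] I by blast+
    then have "x \<otimes> (i \<otimes> j) = (x \<otimes> i) \<otimes> j" using xR by (simp add: m_assoc)
    then show ?case using ideal_prod.prod[OF ideal_pow_mult[OF I(1) x prod(1)] prod(2)] by metis
  next
    case (sum s t)
    then have "s \<in> carrier R" "t \<in> carrier R"
      using ideal.Icarr[OF ideal_prod_is_ideal[OF ideal_pow_ideal ideal_pow_ideal]] I by blast+
    then show ?case using sum.IH xR by (simp add: r_distr ideal_prod.sum)
  qed
qed

lemma bipow_mult_right:
  assumes I: "ideal I1 R" "ideal I2 R" and x: "x \<in> I2" and y: "y \<in> bipow R I1 I2 n1 (n2 - 1)"
  shows "x \<otimes> y \<in> bipow R I1 I2 n1 n2"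
  using bipow_mult_left[OF I(2,1) x, of y n2 n1] y by (simp add: bipow_commute[OF I])

lemma radical_subset_radical_ideal_pow:
  assumes I: "ideal I R"
  shows "radical R I \<subseteq> radical R (ideal_pow R I n)"
proof
  fix r assume "r \<in> radical R I"
  then obtain p :: nat where r: "r \<in> carrier R" and p: "r [^] p \<in> I" by (auto simp: radical_def)
  have "(r [^] p) [^] k \<in> I [^]\<^bsub>ideals_set R\<^esub> k" for k :: nat
  proof (induction k)
    case (Suc k)
    then show ?case using p by (auto simp: ideals_set_def intro: ideal_prod.prod)
  qed (simp add: ideals_set_def)
  from this[of "nat n"] show "r \<in> radical R (ideal_pow R I n)"
    using r by (auto simp: radical_def ideal_pow_def nat_pow_pow)
qed

lemma radical_subset_radical_bipow:
  assumes I: "ideal I1 R" "ideal I2 R"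
  shows "radical R I1 \<inter> radical R I2 \<subseteq> radical R (bipow R I1 I2 n1 n2)"
proof
  fix r assume "r \<in> radical R I1 \<inter> radical R I2"
  then have "r \<in> radical R (ideal_pow R I1 n1)" "r \<in> radical R (ideal_pow R I2 n2)"
    using radical_subset_radical_ideal_pow I by blast+
  then obtain p q :: nat where r: "r \<in> carrier R"
    and "r [^] p \<in> ideal_pow R I1 n1" "r [^] q \<in> ideal_pow R I2 n2" by (auto simp: radical_def)
  then have "r [^] p \<otimes> r [^] q \<in> bipow R I1 I2 n1 n2"
    unfolding bipow_def by (intro ideal_prod.prod)
  then show "r \<in> radical R (bipow R I1 I2 n1 n2)" using r by (auto simp: radical_def nat_pow_mult)
qed

end

section \<open>Linear combinations of finitely many elements\<close>

text \<open>The elements \<open>\<Sum> x\<^sub>a c\<^sub>a\<close> with all \<open>c\<^sub>a \<in> J\<close>. For an ideal \<open>J\<close> they form the product of \<open>J\<close> with the ideal generated by the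
\<open>x\<^sub>a\<close>, which is how ideal products are matched with images of the Koszul differential.\<close>

definition lincombs :: "('a, 'c) ring_scheme \<Rightarrow> ('i \<Rightarrow> 'a) \<Rightarrow> 'i set \<Rightarrow> 'a set \<Rightarrow> 'a set" where
  "lincombs R x A J = {\<Oplus>\<^bsub>R\<^esub>a\<in>A. x a \<otimes>\<^bsub>R\<^esub> c a | c. c \<in> A \<rightarrow> J}"

context cring begin

lemma lincombs_add:
  assumes A: "finite A" and x: "x ` A \<subseteq> carrier R" and J: "ideal J R"
    and s: "s \<in> lincombs R x A J" and t: "t \<in> lincombs R x A J"
  shows "s \<oplus> t \<in> lincombs R x A J"
proof -
  interpret J: ideal J R by (rule J)
  obtain c d where c: "c \<in> A \<rightarrow> J" "s = (\<Oplus>a\<in>A. x a \<otimes> c a)" and d: "d \<in> A \<rightarrow> J" "t = (\<Oplus>a\<in>A. x a \<otimes> d a)"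
    using s t by (auto simp: lincombs_def)
  have cR: "\<And>a. a \<in> A \<Longrightarrow> c a \<in> carrier R" "\<And>a. a \<in> A \<Longrightarrow> d a \<in> carrier R" "\<And>a. a \<in> A \<Longrightarrow> x a \<in> carrier R"
    using c d x J.Icarr by (auto simp: Pi_iff)
  then have "s \<oplus> t = (\<Oplus>a\<in>A. x a \<otimes> c a \<oplus> x a \<otimes> d a)"
    using c d by (simp add: finsum_addf Pi_iff)
  also have "\<dots> = (\<Oplus>a\<in>A. x a \<otimes> (c a \<oplus> d a))"
    using cR by (intro finsum_cong') (auto simp: r_distr)
  finally show ?thesis using c d unfolding lincombs_def by (auto intro!: exI[of _ "\<lambda>a. c a \<oplus> d a"])
qed

lemma lincombs_smult:
  assumes A: "finite A" and x: "x ` A \<subseteq> carrier R" and J: "J \<subseteq> carrier R"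
    and s: "s \<in> lincombs R x A J" and r: "r \<in> carrier R" and K: "\<And>j. j \<in> J \<Longrightarrow> j \<otimes> r \<in> K"
  shows "s \<otimes> r \<in> lincombs R x A K"
proof -
  obtain c where c: "c \<in> A \<rightarrow> J" "s = (\<Oplus>a\<in>A. x a \<otimes> c a)" using s by (auto simp: lincombs_def)
  have cR: "\<And>a. a \<in> A \<Longrightarrow> c a \<in> carrier R" "\<And>a. a \<in> A \<Longrightarrow> x a \<in> carrier R"
    using c x J by (auto simp: Pi_iff)
  then have "s \<otimes> r = (\<Oplus>a\<in>A. x a \<otimes> c a \<otimes> r)"
    using c r A by (simp add: finsum_ldistr Pi_iff)
  also have "\<dots> = (\<Oplus>a\<in>A. x a \<otimes> (c a \<otimes> r))"
    using cR r by (intro finsum_cong') (auto simp: m_assoc)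
  finally show ?thesis using c K unfolding lincombs_def by (auto intro!: exI[of _ "\<lambda>a. c a \<otimes> r"] simp: Pi_iff)
qed

lemma lincombs_ideal:
  assumes A: "finite A" and x: "x ` A \<subseteq> carrier R" and J: "ideal J R"
  shows "ideal (lincombs R x A J) R"
proof -
  interpret J: ideal J R by (rule J)
  interpret S: module R "self_module R" by (rule self_module)
  have sub: "lincombs R x A J \<subseteq> carrier R"
    using x J.Icarr by (auto simp: lincombs_def Pi_iff intro!: finsum_closed)
  have "\<zero> = (\<Oplus>a\<in>A. x a \<otimes> \<zero>)" using x by (subst add.finprod_one_eqI) (auto simp: Pi_iff)
  then have 0: "\<zero> \<in> lincombs R x A J" unfolding lincombs_def by (auto intro!: exI[of _ "\<lambda>_. \<zero>"])
  have "submodule (lincombs R x A J) R (self_module R)"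
  proof (rule S.submoduleI_smult)
    fix r s assume r: "r \<in> carrier R" and s: "s \<in> lincombs R x A J"
    have "s \<otimes> r \<in> lincombs R x A J"
      by (rule lincombs_smult[OF A x J.a_subset s r]) (rule J.I_r_closed[OF _ r])
    then show "r \<odot>\<^bsub>self_module R\<^esub> s \<in> lincombs R x A J"
      using r s sub by (auto simp: self_module_def m_comm)
  qed (use sub 0 lincombs_add[OF A x J] in \<open>auto simp: self_module_def\<close>)
  then show ?thesis by (simp add: submodule_self_iff)
qed

lemma ideal_finsum_closed:
  assumes J: "ideal J R" and "\<And>a. a \<in> A \<Longrightarrow> f a \<in> J"
  shows "(\<Oplus>a\<in>A. f a) \<in> J"
proof -
  interpret J: ideal J R by (rule J)
  show ?thesis
    using assms(2) by (induction A rule: infinite_finite_induct) (auto simp: Pi_iff J.Icarr)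
qed

lemma genideal_eq_lincombs:
  assumes A: "finite A" and x: "x ` A \<subseteq> carrier R"
  shows "Idl (x ` A) = lincombs R x A (carrier R)"
proof
  have gen: "x a \<in> lincombs R x A (carrier R)" if a: "a \<in> A" for a
  proof -
    have "x a = (\<Oplus>b\<in>A. if a = b then x b else \<zero>)"
      using a A x by (subst finsum_singleton) (auto simp: Pi_iff)
    also have "\<dots> = (\<Oplus>b\<in>A. x b \<otimes> (if a = b then \<one> else \<zero>))"
      using x by (intro finsum_cong') auto
    finally show ?thesis by (auto simp: lincombs_def intro!: exI[of _ "\<lambda>b. if a = b then \<one> else \<zero>"])
  qed
  then show "Idl (x ` A) \<subseteq> lincombs R x A (carrier R)"
    by (intro genideal_minimal lincombs_ideal A x oneideal) auto
  show "lincombs R x A (carrier R) \<subseteq> Idl (x ` A)"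
    using genideal_self[OF x] ideal.I_r_closed[OF genideal_ideal[OF x]]
    by (auto simp: lincombs_def intro!: ideal_finsum_closed genideal_ideal x)
qed

theorem genideal_prod_eq_lincombs:
  assumes A: "finite A" and x: "x ` A \<subseteq> carrier R" and J: "ideal J R"
  shows "(Idl (x ` A)) \<cdot> J = lincombs R x A J"
proof
  interpret J: ideal J R by (rule J)
  show "(Idl (x ` A)) \<cdot> J \<subseteq> lincombs R x A J"
  proof
    fix s assume "s \<in> (Idl (x ` A)) \<cdot> J"
    then show "s \<in> lincombs R x A J"
    proof (induction s rule: ideal_prod.induct)
      case (prod i j)
      then show ?case
        using lincombs_smult[OF A x subset_refl, of i j J] J.Icarr J.I_l_closed
        by (auto simp: genideal_eq_lincombs[OF A x])
    qed (rule lincombs_add[OF A x J])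
  qed
  have "x a \<in> Idl (x ` A)" if "a \<in> A" for a using genideal_self[OF x] that by auto
  then show "lincombs R x A J \<subseteq> (Idl (x ` A)) \<cdot> J"
    by (auto simp: lincombs_def Pi_iff intro!: ideal_finsum_closed ideal_prod_is_ideal genideal_ideal x J
        ideal_prod.prod)
qed

end


section \<open>Free modules of finite rank\<close>

definition pow_module :: "('a, 'c) ring_scheme \<Rightarrow> 'i set \<Rightarrow> ('a, 'i \<Rightarrow> 'a) module" where
  "pow_module R S = \<lparr>carrier = S \<rightarrow>\<^sub>E carrier R, monoid.mult = undefined, monoid.one = undefined,
     ring.zero = (\<lambda>s\<in>S. \<zero>\<^bsub>R\<^esub>), ring.add = (\<lambda>c c'. \<lambda>s\<in>S. c s \<oplus>\<^bsub>R\<^esub> c' s),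
     smult = (\<lambda>r c. \<lambda>s\<in>S. r \<otimes>\<^bsub>R\<^esub> c s)\<rparr>"

lemma koszul_eq_pow_module: "koszul R k1 k2 i = pow_module R (kos_index k1 k2 i)"
  by (simp add: koszul_def pow_module_def)

context cring begin

lemma pow_module: "module R (pow_module R S)"
proof -
  have "abelian_group (pow_module R S)"
  proof (rule abelian_groupI)
    fix x assume x: "x \<in> carrier (pow_module R S)"
    show "\<zero>\<^bsub>pow_module R S\<^esub> \<oplus>\<^bsub>pow_module R S\<^esub> x = x"
      using x by (auto simp: pow_module_def PiE_iff extensional_def fun_eq_iff)
    have "(\<lambda>s\<in>S. \<ominus> x s) \<oplus>\<^bsub>pow_module R S\<^esub> x = \<zero>\<^bsub>pow_module R S\<^esub>"
      using x by (auto simp: pow_module_def PiE_iff l_neg intro!: restrict_ext)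
    then show "\<exists>y\<in>carrier (pow_module R S). y \<oplus>\<^bsub>pow_module R S\<^esub> x = \<zero>\<^bsub>pow_module R S\<^esub>"
      using x by (intro bexI[of _ "\<lambda>s\<in>S. \<ominus> x s"]) (auto simp: pow_module_def PiE_iff)
  qed (auto simp: pow_module_def PiE_iff a_ac intro!: restrict_ext)
  then show ?thesis
    by (intro moduleI is_cring)
      (auto simp: pow_module_def PiE_iff l_distr r_distr m_assoc extensional_def fun_eq_iff intro!: restrict_ext)
qed

lemma eval_linear_map:
  assumes "s \<in> S"
  shows "linear_map R (pow_module R S) (self_module R) (\<lambda>c. c s)"
  by (intro linear_map.intro linear_map_axioms.intro pow_module self_module)
    (use assms in \<open>auto simp: pow_module_def self_module_def PiE_iff\<close>)

lemma PiE_submodule: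
  assumes "\<And>s. s \<in> S \<Longrightarrow> ideal (J s) R"
  shows "submodule (\<Pi>\<^sub>E s\<in>S. J s) R (pow_module R S)"
proof -
  interpret P: module R "pow_module R S" by (rule pow_module)
  have J: "additive_subgroup (J s) R" if "s \<in> S" for s using assms[OF that] by (rule ideal.axioms(1))
  show ?thesis
    by (rule P.submoduleI_smult)
      (use assms additive_subgroup.a_Hcarr[OF J] additive_subgroup.zero_closed[OF J]
        additive_subgroup.a_closed[OF J] ideal.I_l_closed[OF assms]
        in \<open>auto simp: pow_module_def PiE_iff\<close>)
qed

text \<open>Length is additive over direct sums: replace the ideals \<open>J s\<close> by the whole ring one index at a time; each
step is compared with \<open>R / J t\<close> through evaluation at \<open>t\<close>.\<close>

lemma interval_length_PiE:
  assumes S: "finite S" and J: "\<And>s. s \<in> S \<Longrightarrow> ideal (J s) R"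
  shows "interval_length R (pow_module R S) (\<Pi>\<^sub>E s\<in>S. J s) (carrier (pow_module R S))
    = (\<Sum>s\<in>S. interval_length R (self_module R) (J s) (carrier R))"
proof -
  interpret P: module R "pow_module R S" by (rule pow_module)
  let ?G = "\<lambda>T. \<Pi>\<^sub>E s\<in>S. if s \<in> T then carrier R else J s"
  have JR: "J s \<subseteq> carrier R" if "s \<in> S" for s
    using J[OF that] by (rule additive_subgroup.a_subset[OF ideal.axioms(1)])
  have G: "submodule (?G T) R (pow_module R S)" for T
    by (rule PiE_submodule) (auto simp: J oneideal)
  have G_mono: "?G T \<subseteq> ?G T'" if "T \<subseteq> T'" for T T'
    using that JR by (intro PiE_mono) auto
  have "interval_length R (pow_module R S) (?G {}) (?G T)
      = (\<Sum>s\<in>T. interval_length R (self_module R) (J s) (carrier R))" if "T \<subseteq> S" for T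
    using finite_subset[OF that S] that
  proof (induction T rule: finite_induct)
    case empty
    then show ?case by (simp add: interval_length_refl)
  next
    case (insert t T)
    interpret eval: linear_map R "pow_module R S" "self_module R" "\<lambda>c. c t"
      using insert by (intro eval_linear_map) auto
    have tS: "t \<in> S" using insert by auto
    have "?G T \<subseteq> ?G (insert t T)" by (rule G_mono) auto
    moreover have "c t \<in> J t" if "c \<in> ?G T" for c using that tS insert(2) by (auto simp: PiE_iff)
    moreover have "c \<in> ?G T" if "c \<in> ?G (insert t T)" "c t \<in> J t" for c
      using that by (fastforce simp: PiE_iff split: if_splits)
    ultimately have *: "?G T = {c \<in> ?G (insert t T). c t \<in> J t}" by blast
    have "c t \<in> carrier R" if "c \<in> ?G (insert t T)" for c using PiE_mem[OF that tS] by simp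
    then have **: "?G (insert t T) = {c \<in> ?G (insert t T). c t \<in> carrier R}" by blast
    have surj: "carrier R \<subseteq> (\<lambda>c. c t) ` ?G (insert t T)"
    proof
      fix r assume r: "r \<in> carrier R"
      have "(\<lambda>s\<in>S. if s = t then r else \<zero>) \<in> ?G (insert t T)"
        using r ideal.axioms(1)[OF J, THEN additive_subgroup.zero_closed] by (auto simp: PiE_iff)
      then show "r \<in> (\<lambda>c. c t) ` ?G (insert t T)" by (rule image_eqI[rotated]) (simp add: tS)
    qed
    have subm: "submodule (J t) R (self_module R)" "submodule (carrier R) R (self_module R)"
      using J[OF tS] oneideal by (auto simp: submodule_self_iff)
    have "submodule ((\<lambda>c. c t) ` ?G (insert t T)) R (self_module R)" by (rule eval.image_submodule[OF G])
    then have "carrier R \<subseteq> J t <+>\<^bsub>self_module R\<^esub> (\<lambda>c. c t) ` ?G (insert t T)"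
      using eval.N.set_add_subset_right[OF subm(1)] surj by blast
    then have "interval_length R (self_module R) (J t) (carrier R)
        = interval_length R (pow_module R S) (?G T) (?G (insert t T))"
      using eval.interval_length_preimage_on[OF G[of "insert t T"] subm JR[OF tS]] * ** by simp
    then show ?case
      using insert P.interval_length_additive[OF G[of "{}"] G[of T] G[of "insert t T"] G_mono G_mono]
      by (auto simp: add.commute)
  qed
  from this[of S] show ?thesis by (simp add: pow_module_def cong: PiE_cong)
qed

end

section \<open>The Koszul differential of a sequence\<close>

text \<open>The Koszul differential of a single sequence \<open>y\<^sub>1, \<dots>, y\<^sub>k\<close>, with coordinates indexed by subsets of \<open>{1..k}\<close>: the
coordinate at \<open>T\<close> of the differential of \<open>c\<close>. Working with one index set instead of pairs \<open>(A, B)\<close> avoids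
distinguishing the two parts in the sign computations.\<close>

definition koszul_sum :: "('a, 'c) ring_scheme \<Rightarrow> (nat \<Rightarrow> 'a) \<Rightarrow> nat \<Rightarrow> (nat set \<Rightarrow> 'a) \<Rightarrow> nat set \<Rightarrow> 'a" where
  "koszul_sum R y k c T = (\<Oplus>\<^bsub>R\<^esub>s\<in>{1..k} - T.
     (\<ominus>\<^bsub>R\<^esub> \<one>\<^bsub>R\<^esub>) [^]\<^bsub>R\<^esub> card {t\<in>T. t < s} \<otimes>\<^bsub>R\<^esub> y s \<otimes>\<^bsub>R\<^esub> c (insert s T))"

context cring begin

lemma sign_closed [simp]: "(\<ominus> \<one>) [^] (n::nat) \<in> carrier R" by simp

lemma koszul_sum_closed:
  assumes "\<And>s. s \<in> {1..k} - T \<Longrightarrow> y s \<in> carrier R" "\<And>s. s \<in> {1..k} - T \<Longrightarrow> c (insert s T) \<in> carrier R"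
  shows "koszul_sum R y k c T \<in> carrier R"
  unfolding koszul_sum_def using assms by (intro finsum_closed) auto

lemma koszul_sum_add:
  assumes "\<And>s. s \<in> {1..k} - T \<Longrightarrow> y s \<in> carrier R"
    "\<And>s. s \<in> {1..k} - T \<Longrightarrow> c (insert s T) \<in> carrier R" "\<And>s. s \<in> {1..k} - T \<Longrightarrow> c' (insert s T) \<in> carrier R"
  shows "koszul_sum R y k (\<lambda>S. c S \<oplus> c' S) T = koszul_sum R y k c T \<oplus> koszul_sum R y k c' T"
proof -
  have "koszul_sum R y k (\<lambda>S. c S \<oplus> c' S) T = (\<Oplus>s\<in>{1..k} - T.
     (\<ominus> \<one>) [^] card {t\<in>T. t < s} \<otimes> y s \<otimes> c (insert s T) \<oplus> (\<ominus> \<one>) [^] card {t\<in>T. t < s} \<otimes> y s \<otimes> c' (insert s T))"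
    unfolding koszul_sum_def using assms by (intro finsum_cong') (auto simp: r_distr)
  then show ?thesis unfolding koszul_sum_def using assms by (simp add: finsum_addf Pi_iff)
qed

lemma koszul_sum_smult:
  assumes "\<And>s. s \<in> {1..k} - T \<Longrightarrow> y s \<in> carrier R"
    "\<And>s. s \<in> {1..k} - T \<Longrightarrow> c (insert s T) \<in> carrier R" "r \<in> carrier R"
  shows "koszul_sum R y k (\<lambda>S. r \<otimes> c S) T = r \<otimes> koszul_sum R y k c T"
proof -
  have "koszul_sum R y k (\<lambda>S. r \<otimes> c S) T = (\<Oplus>s\<in>{1..k} - T.
     r \<otimes> ((\<ominus> \<one>) [^] card {t\<in>T. t < s} \<otimes> y s \<otimes> c (insert s T)))"
    unfolding koszul_sum_def using assms by (intro finsum_cong') (auto simp: m_ac)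
  then show ?thesis unfolding koszul_sum_def using assms by (simp add: finsum_rdistr Pi_iff)
qed

lemma koszul_sum_cong:
  assumes "\<And>s. s \<in> {1..k} - T \<Longrightarrow> y s \<in> carrier R" "\<And>s. s \<in> {1..k} - T \<Longrightarrow> c' (insert s T) \<in> carrier R"
    "\<And>s. s \<in> {1..k} - T \<Longrightarrow> c (insert s T) = c' (insert s T)"
  shows "koszul_sum R y k c T = koszul_sum R y k c' T"
  unfolding koszul_sum_def using assms by (intro finsum_cong') auto

text \<open>Terms at \<open>(s, t)\<close> and \<open>(t, s)\<close> cancel in pairs. Nothing is divided by two, so the characteristic does not matter.\<close>

lemma finsum_alternating_eq_zero:
  assumes "finite A" and "\<And>s t. s \<in> A \<Longrightarrow> t \<in> A \<Longrightarrow> s \<noteq> t \<Longrightarrow> f s t \<in> carrier R"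
    and "\<And>s t. s \<in> A \<Longrightarrow> t \<in> A \<Longrightarrow> s \<noteq> t \<Longrightarrow> f s t \<oplus> f t s = \<zero>"
  shows "(\<Oplus>s\<in>A. \<Oplus>t\<in>A - {s}. f s t) = \<zero>"
  using assms
proof (induction A rule: finite_induct)
  case (insert u A)
  have c: "f s t \<in> carrier R" if "s \<in> insert u A" "t \<in> insert u A" "s \<noteq> t" for s t
    using insert.prems that by blast
  have uA: "\<And>s. s \<in> A \<Longrightarrow> s \<noteq> u" using insert by blast
  have inner: "(\<Oplus>t\<in>insert u A - {s}. f s t) = f s u \<oplus> (\<Oplus>t\<in>A - {s}. f s t)" if s: "s \<in> A" for s
  proof -
    have "insert u A - {s} = insert u (A - {s})" using uA s by auto
    then show ?thesis using insert(1,2) c s uA by (simp only:, subst finsum_insert) auto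
  qed
  have inner_c: "(\<Oplus>t\<in>A - {s}. f s t) \<in> carrier R" if "s \<in> A" for s
    using c that by (intro finsum_closed) auto
  have first_c: "(\<Oplus>t\<in>A. f u t) \<in> carrier R" using c uA by (intro finsum_closed) auto
  have "(\<Oplus>s\<in>A. \<Oplus>t\<in>insert u A - {s}. f s t) = (\<Oplus>s\<in>A. f s u \<oplus> (\<Oplus>t\<in>A - {s}. f s t))"
    using inner inner_c c uA by (intro finsum_cong') auto
  also have "\<dots> = (\<Oplus>s\<in>A. f s u) \<oplus> (\<Oplus>s\<in>A. \<Oplus>t\<in>A - {s}. f s t)"
    using inner_c c uA by (intro finsum_addf) auto
  also have "(\<Oplus>s\<in>A. \<Oplus>t\<in>A - {s}. f s t) = \<zero>" using insert.prems by (intro insert.IH) auto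
  finally have rest: "(\<Oplus>s\<in>A. \<Oplus>t\<in>insert u A - {s}. f s t) = (\<Oplus>s\<in>A. f s u)"
    using c uA by (simp add: Pi_iff)
  have "insert u A - {u} = A" using insert by auto
  then have "(\<Oplus>s\<in>insert u A. \<Oplus>t\<in>insert u A - {s}. f s t)
      = (\<Oplus>t\<in>A. f u t) \<oplus> (\<Oplus>s\<in>A. \<Oplus>t\<in>insert u A - {s}. f s t)"
    using insert(1,2) c uA inner inner_c first_c by (subst finsum_insert) (auto simp: Pi_iff)
  also have "\<dots> = (\<Oplus>t\<in>A. f u t \<oplus> f t u)"
    unfolding rest using c uA by (intro finsum_addf[symmetric]) auto
  also have "\<dots> = \<zero>" using insert.prems(2)[of u] uA by (intro add.finprod_one_eqI) auto
  finally show ?case .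
qed simp

lemma card_insert_less:
  assumes "finite T" "s \<notin> T"
  shows "card {u \<in> insert s T. u < (t::nat)} = (if s < t then Suc (card {u \<in> T. u < t}) else card {u \<in> T. u < t})"
proof -
  have "{u \<in> insert s T. u < t} = (if s < t then insert s {u \<in> T. u < t} else {u \<in> T. u < t})" by auto
  then show ?thesis using assms by simp
qed

text \<open>Removing \<open>s < t\<close> in the two possible orders gives opposite signs: the position of \<open>t\<close> is shifted by one by the
presence of \<open>s\<close>, while the position of \<open>s\<close> does not see \<open>t\<close>.\<close>

theorem koszul_sum_koszul_sum:
  assumes T: "T \<subseteq> {1..k}" and y: "\<And>s. s \<in> {1..k} \<Longrightarrow> y s \<in> carrier R"
    and c: "\<And>s t. s \<in> {1..k} - T \<Longrightarrow> t \<in> {1..k} - T \<Longrightarrow> s \<noteq> t \<Longrightarrow> c (insert s (insert t T)) \<in> carrier R"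
  shows "koszul_sum R y k (koszul_sum R y k c) T = \<zero>"
proof -
  have fT: "finite T" using T finite_subset by auto
  let ?A = "{1..k} - T"
  let ?f = "\<lambda>s t. (\<ominus> \<one>) [^] card {u\<in>T. u < s} \<otimes> y s \<otimes>
     ((\<ominus> \<one>) [^] card {u\<in>insert s T. u < t} \<otimes> y t \<otimes> c (insert t (insert s T)))"
  have fc: "?f s t \<in> carrier R" if "s \<in> ?A" "t \<in> ?A" "s \<noteq> t" for s t
    using y c that by simp
  have alt: "?f s t \<oplus> ?f t s = \<zero>" if st: "s \<in> ?A" "t \<in> ?A" "s < t" for s t
  proof -
    let ?p = "(\<ominus> \<one>) [^] card {u\<in>T. u < s}" and ?q = "(\<ominus> \<one>) [^] card {u\<in>T. u < t}"
      and ?c = "c (insert s (insert t T))"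
    have cc: "?c \<in> carrier R" "y s \<in> carrier R" "y t \<in> carrier R" using y c st by auto
    have "card {u\<in>insert s T. u < t} = Suc (card {u\<in>T. u < t})"
        "card {u\<in>insert t T. u < s} = card {u\<in>T. u < s}"
      using card_insert_less[OF fT, of s t] card_insert_less[OF fT, of t s] st by simp_all
    note cards = this
    have "?f s t = ?p \<otimes> y s \<otimes> ((?q \<otimes> \<ominus> \<one>) \<otimes> y t \<otimes> ?c)"
      by (simp only: cards nat_pow_Suc insert_commute[of t s T])
    moreover have "?f t s = ?q \<otimes> y t \<otimes> (?p \<otimes> y s \<otimes> ?c)"
      by (simp only: cards)
    moreover have "p \<otimes> a \<otimes> ((q \<otimes> \<ominus> \<one>) \<otimes> b \<otimes> d) \<oplus> q \<otimes> b \<otimes> (p \<otimes> a \<otimes> d) = \<zero>"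
      if "p \<in> carrier R" "q \<in> carrier R" "a \<in> carrier R" "b \<in> carrier R" "d \<in> carrier R" for p q a b d
      using that by algebra
    ultimately show ?thesis using cc by simp
  qed
  have "koszul_sum R y k (koszul_sum R y k c) T = (\<Oplus>s\<in>?A. \<Oplus>t\<in>?A - {s}. ?f s t)"
  proof -
    have "(\<ominus> \<one>) [^] card {u\<in>T. u < s} \<otimes> y s \<otimes> koszul_sum R y k c (insert s T) = (\<Oplus>t\<in>?A - {s}. ?f s t)"
      if s: "s \<in> ?A" for s
    proof -
      have "{1..k} - insert s T = ?A - {s}" by auto
      then show ?thesis
        unfolding koszul_sum_def using s y c by (subst finsum_rdistr) (auto simp: insert_commute)
    qed
    moreover have "(\<Oplus>t\<in>?A - {s}. ?f s t) \<in> carrier R" if "s \<in> ?A" for s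
      using fc that by (intro finsum_closed) auto
    ultimately show ?thesis
      unfolding koszul_sum_def[of R y k _ T] by (intro finsum_cong') auto
  qed
  also have "\<dots> = \<zero>"
  proof (rule finsum_alternating_eq_zero)
    fix s t assume st: "s \<in> ?A" "t \<in> ?A" "s \<noteq> t"
    then show "?f s t \<oplus> ?f t s = \<zero>"
      using alt[of s t] alt[of t s] a_comm[OF fc[OF st] fc[of t s]] by (cases "s < t") auto
  qed (use fc in auto)
  finally show ?thesis .
qed

text \<open>A regular sequence has only Koszul syzygies, that is, its Koszul complex is exact in degree one. By regularity
the last coefficient is \<open>c\<^sub>n\<^sub>+\<^sub>1 = \<Sum> y\<^sub>s e\<^sub>s\<close> over \<open>s \<le> n\<close>. Subtracting the Koszul relations between \<open>y\<^sub>s\<close> and \<open>y\<^sub>n\<^sub>+\<^sub>1\<close> with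
coefficients \<open>e\<^sub>s\<close> leaves the syzygy \<open>c\<^sub>s + y\<^sub>n\<^sub>+\<^sub>1 e\<^sub>s\<close> of the shorter sequence, to which induction applies. The
coefficients \<open>b\<close> are recorded as a function on all subsets, of which only the two-element ones matter.\<close>

theorem regular_sequence_syzygy:
  assumes y: "y ` {1..n} \<subseteq> carrier R"
    and reg: "\<And>i r. i \<in> {1..n} \<Longrightarrow> r \<in> carrier R \<Longrightarrow> y i \<otimes> r \<in> Idl (y ` {1..<i}) \<Longrightarrow> r \<in> Idl (y ` {1..<i})"
    and c: "\<And>s. s \<in> {1..n} \<Longrightarrow> c s \<in> carrier R" and 0: "(\<Oplus>s\<in>{1..n}. y s \<otimes> c s) = \<zero>"
  shows "\<exists>b. (\<forall>S. b S \<in> carrier R) \<and> (\<forall>s\<in>{1..n}. koszul_sum R y n b {s} = c s)"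
  using assms
proof (induction n arbitrary: c)
  case 0
  then show ?case by (intro exI[of _ "\<lambda>_. \<zero>"]) auto
next
  case (Suc n)
  let ?z = "y (Suc n)"
  have yR: "\<And>s. s \<in> {1..Suc n} \<Longrightarrow> y s \<in> carrier R" using Suc.prems(1) by auto
  have yR': "y ` {1..n} \<subseteq> carrier R" using Suc.prems(1) by auto
  have zR: "?z \<in> carrier R" "c (Suc n) \<in> carrier R" using yR[of "Suc n"] Suc.prems(3)[of "Suc n"] by auto
  have cR: "\<And>s. s \<in> {1..n} \<Longrightarrow> c s \<in> carrier R" using Suc.prems(3) by auto
  have Idl: "Idl (y ` {1..<Suc n}) = lincombs R y {1..n} (carrier R)"
    using genideal_eq_lincombs[of "{1..n}" y] yR' by (simp add: atLeastLessThanSuc_atLeastAtMost)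
  have sum_c: "(\<Oplus>s\<in>{1..n}. y s \<otimes> c s) \<in> lincombs R y {1..n} (carrier R)"
    using cR by (auto simp: lincombs_def)
  interpret L: ideal "lincombs R y {1..n} (carrier R)" R
    by (rule lincombs_ideal[OF _ yR' oneideal]) simp
  have "{1..Suc n} = insert (Suc n) {1..n}" by auto
  then have split: "?z \<otimes> c (Suc n) \<oplus> (\<Oplus>s\<in>{1..n}. y s \<otimes> c s) = \<zero>"
    using Suc.prems(4) zR yR' cR by (simp only:, subst (asm) finsum_insert) auto
  then have "?z \<otimes> c (Suc n) = \<ominus> (\<Oplus>s\<in>{1..n}. y s \<otimes> c s)"
    using zR L.Icarr[OF sum_c] by (intro minus_equality[symmetric]) auto
  then have "c (Suc n) \<in> lincombs R y {1..n} (carrier R)"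
    using Suc.prems(2)[of "Suc n" "c (Suc n)"] zR L.a_inv_closed[OF sum_c] unfolding Idl by simp
  then obtain e where e: "e \<in> {1..n} \<rightarrow> carrier R" and ce: "c (Suc n) = (\<Oplus>s\<in>{1..n}. y s \<otimes> e s)"
    unfolding lincombs_def mem_Collect_eq by blast
  have eR: "\<And>s. s \<in> {1..n} \<Longrightarrow> e s \<in> carrier R" using e by auto
  let ?c' = "\<lambda>s. c s \<oplus> ?z \<otimes> e s"
  have "(\<Oplus>s\<in>{1..n}. y s \<otimes> ?c' s) = (\<Oplus>s\<in>{1..n}. y s \<otimes> c s \<oplus> ?z \<otimes> (y s \<otimes> e s))"
    using yR cR eR zR by (intro finsum_cong') (auto simp: r_distr m_lcomm)
  also have "\<dots> = (\<Oplus>s\<in>{1..n}. y s \<otimes> c s) \<oplus> ?z \<otimes> c (Suc n)"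
    unfolding ce using yR cR eR zR by (simp add: finsum_addf finsum_rdistr Pi_iff)
  also have "\<dots> = \<zero>" using split zR L.Icarr[OF sum_c] by (simp add: a_comm)
  finally have "(\<Oplus>s\<in>{1..n}. y s \<otimes> ?c' s) = \<zero>" .
  then have "\<exists>b. (\<forall>S. b S \<in> carrier R) \<and> (\<forall>s\<in>{1..n}. koszul_sum R y n b {s} = ?c' s)"
    using Suc.prems(2) cR eR zR by (intro Suc.IH[OF yR']) auto
  then obtain b where b: "\<And>S. b S \<in> carrier R" "\<And>s. s \<in> {1..n} \<Longrightarrow> koszul_sum R y n b {s} = ?c' s"
    by blast
  \<comment> \<open>on \<open>{s, Suc n}\<close> with \<open>s \<le> n\<close>, the other element is the minimum\<close>
  let ?b = "\<lambda>S. if Suc n \<in> S \<and> Min S \<in> {1..n} then e (Min S) else b S"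
  have bR: "?b S \<in> carrier R" for S using b(1) eR by simp
  have "koszul_sum R y (Suc n) ?b {s} = c s" if s: "s \<in> {1..Suc n}" for s
  proof (cases "s = Suc n")
    case True
    have "(\<ominus> \<one>) [^] card {t \<in> {Suc n}. t < u} \<otimes> y u \<otimes> ?b (insert u {Suc n}) = y u \<otimes> e u"
      if u: "u \<in> {1..n}" for u
    proof -
      have "{t \<in> {Suc n}. t < u} = {}" "Min (insert u {Suc n}) = u" using u by auto
      then show ?thesis using u yR[of u] eR[OF u] by (simp only: card.empty) simp
    qed
    moreover have "{1..Suc n} - {Suc n} = {1..n}" by auto
    ultimately show ?thesis
      unfolding koszul_sum_def True ce using yR eR by (intro finsum_cong') auto
  next
    case False
    then have sn: "s \<in> {1..n}" using s by auto
    have eq: "{1..Suc n} - {s} = insert (Suc n) ({1..n} - {s})" using sn by auto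
    have "{t \<in> {s}. t < Suc n} = {s}" "Min (insert (Suc n) {s}) = s" using sn by auto
    then have "(\<ominus> \<one>) [^] card {t \<in> {s}. t < Suc n} \<otimes> ?z \<otimes> ?b (insert (Suc n) {s}) = (\<ominus> \<one>) \<otimes> ?z \<otimes> e s"
      using sn by (simp only:) simp
    moreover have "koszul_sum R y (Suc n) ?b {s} =
        (\<ominus> \<one>) [^] card {t \<in> {s}. t < Suc n} \<otimes> ?z \<otimes> ?b (insert (Suc n) {s}) \<oplus> koszul_sum R y n ?b {s}"
      unfolding koszul_sum_def eq
    proof (rule finsum_insert)
      have tc: "(\<ominus> \<one>) [^] (p::nat) \<otimes> y u \<otimes> ?b S \<in> carrier R" if "u \<in> {1..Suc n}" for p u S
        by (intro m_closed sign_closed bR yR that)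
      show "(\<lambda>u. (\<ominus> \<one>) [^] card {t \<in> {s}. t < u} \<otimes> y u \<otimes> ?b (insert u {s})) \<in> {1..n} - {s} \<rightarrow> carrier R"
        and "(\<ominus> \<one>) [^] card {t \<in> {s}. t < Suc n} \<otimes> ?z \<otimes> ?b (insert (Suc n) {s}) \<in> carrier R"
        by (intro Pi_I tc; simp)+
    qed simp_all
    ultimately have "koszul_sum R y (Suc n) ?b {s} = (\<ominus> \<one>) \<otimes> ?z \<otimes> e s \<oplus> koszul_sum R y n ?b {s}"
      by (simp only:)
    also have "koszul_sum R y n ?b {s} = koszul_sum R y n b {s}"
      using sn yR b by (intro koszul_sum_cong) auto
    also have "\<dots> = c s \<oplus> ?z \<otimes> e s" by (rule b(2)[OF sn])
    also have "(\<ominus> \<one>) \<otimes> ?z \<otimes> e s \<oplus> (c s \<oplus> ?z \<otimes> e s) = c s"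
      using cR[OF sn] eR[OF sn] zR(1) by algebra
    finally show ?thesis .
  qed
  then show ?case using bR by (intro exI[of _ ?b]) blast
qed

end


section \<open>Pairs of index sets as subsets of a single set\<close>

text \<open>The bijection between pairs \<open>(A, B)\<close> and subsets of \<open>{1..k1 + k2}\<close> that places \<open>B\<close> behind \<open>A\<close>, matching
the concatenated sequence.\<close>

definition split_index :: "nat \<Rightarrow> nat \<Rightarrow> nat set \<Rightarrow> nat set \<times> nat set" where
  "split_index k1 k2 S = (S \<inter> {1..k1}, {b \<in> {1..k2}. b + k1 \<in> S})"

definition join_index :: "nat \<Rightarrow> nat set \<times> nat set \<Rightarrow> nat set" where
  "join_index k1 = (\<lambda>(A, B). A \<union> (\<lambda>b. b + k1) ` B)"

lemma finite_kos_index: "finite (kos_index k1 k2 i)"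
proof (rule finite_subset)
  show "kos_index k1 k2 i \<subseteq> Pow {1..k1} \<times> Pow {1..k2}" by (auto simp: kos_index_def)
qed simp

lemma kos_index_finite_sets:
  "(A, B) \<in> kos_index k1 k2 i \<Longrightarrow> finite A \<and> finite B"
  by (auto simp: kos_index_def intro: finite_subset)

lemma join_index_card:
  assumes "(A, B) \<in> kos_index k1 k2 i"
  shows "int (card (join_index k1 (A, B))) = i"
proof -
  have "A \<inter> (\<lambda>b. b + k1) ` B = {}" using assms by (fastforce simp: kos_index_def)
  then show ?thesis
    using kos_index_finite_sets[OF assms] assms
    by (simp add: join_index_def card_Un_disjoint card_image kos_index_def)
qed

lemma join_index_subset: "(A, B) \<in> kos_index k1 k2 i \<Longrightarrow> join_index k1 (A, B) \<subseteq> {1..k1 + k2}"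
  by (fastforce simp: join_index_def kos_index_def)

lemma join_split_index: "S \<subseteq> {1..k1 + k2} \<Longrightarrow> join_index k1 (split_index k1 k2 S) = S"
proof -
  assume S: "S \<subseteq> {1..k1 + k2}"
  have "s \<in> (\<lambda>b. b + k1) ` {b \<in> {1..k2}. b + k1 \<in> S}" if "s \<in> S" "s \<notin> {1..k1}" for s
    using that S by (intro image_eqI[of _ _ "s - k1"]) auto
  then show ?thesis unfolding join_index_def split_index_def prod.case by blast
qed

lemma split_join_index:
  "(A, B) \<in> kos_index k1 k2 i \<Longrightarrow> split_index k1 k2 (join_index k1 (A, B)) = (A, B)"
  by (auto simp: join_index_def split_index_def kos_index_def)

lemma split_index_mem:
  assumes S: "S \<subseteq> {1..k1 + k2}" and "int (card S) = i"
  shows "split_index k1 k2 S \<in> kos_index k1 k2 i"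
proof -
  obtain A B where AB: "split_index k1 k2 S = (A, B)" by (cases "split_index k1 k2 S")
  then have "(A, B) \<in> kos_index k1 k2 (int (card A) + int (card B))"
    by (auto simp: split_index_def kos_index_def)
  then show ?thesis using join_index_card AB join_split_index[OF S] assms(2) by metis
qed

lemma split_insert_join_mem:
  assumes AB: "(A, B) \<in> kos_index k1 k2 (i - 1)" and s: "s \<in> {1..k1 + k2} - join_index k1 (A, B)"
  shows "split_index k1 k2 (insert s (join_index k1 (A, B))) \<in> kos_index k1 k2 i"
proof -
  have "finite (join_index k1 (A, B))" using join_index_subset[OF AB] finite_subset by auto
  then show ?thesis
    using s join_index_subset[OF AB] join_index_card[OF AB] by (intro split_index_mem) auto
qed

lemma split_insert_left:
  "(A, B) \<in> kos_index k1 k2 i \<Longrightarrow> a \<in> {1..k1} \<Longrightarrow>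
    split_index k1 k2 (insert a (join_index k1 (A, B))) = (insert a A, B)"
  by (auto simp: join_index_def split_index_def kos_index_def)

lemma split_insert_right:
  "(A, B) \<in> kos_index k1 k2 i \<Longrightarrow> b \<in> {1..k2} \<Longrightarrow>
    split_index k1 k2 (insert (b + k1) (join_index k1 (A, B))) = (A, insert b B)"
  by (auto simp: join_index_def split_index_def kos_index_def)

lemma kos_index_insert_left:
  assumes "(A, B) \<in> kos_index k1 k2 (i - 1)" "a \<in> {1..k1} - A"
  shows "(insert a A, B) \<in> kos_index k1 k2 i"
  using assms kos_index_finite_sets[OF assms(1)] by (auto simp: kos_index_def)

lemma kos_index_insert_right:
  assumes "(A, B) \<in> kos_index k1 k2 (i - 1)" "b \<in> {1..k2} - B"
  shows "(A, insert b B) \<in> kos_index k1 k2 i"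
  using assms kos_index_finite_sets[OF assms(1)] by (auto simp: kos_index_def)

lemma kos_index_0: "kos_index k1 k2 0 = {({}, {})}"
proof -
  have "A = {} \<and> B = {}" if AB: "(A, B) \<in> kos_index k1 k2 0" for A B
  proof -
    have "card A = 0 \<and> card B = 0" using AB by (auto simp: kos_index_def)
    then show ?thesis using kos_index_finite_sets[OF AB] by simp
  qed
  then show ?thesis by (auto simp: kos_index_def)
qed

lemma kos_index_1: "kos_index k1 k2 1 = (\<lambda>a. ({a}, {})) ` {1..k1} \<union> (\<lambda>b. ({}, {b})) ` {1..k2}"
proof -
  have "s \<in> (\<lambda>a. ({a}, {})) ` {1..k1} \<union> (\<lambda>b. ({}, {b})) ` {1..k2}" if s: "s \<in> kos_index k1 k2 1" for s
  proof -
    obtain A B where AB: "s = (A, B)" "A \<subseteq> {1..k1}" "B \<subseteq> {1..k2}" "card A + card B = 1"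
      using s by (auto simp: kos_index_def)
    then have fin: "finite A" "finite B" using finite_subset by auto
    have "card A = 1 \<and> card B = 0 \<or> card A = 0 \<and> card B = 1" using AB(4) by linarith
    then show ?thesis using AB fin by (auto simp: card_1_singleton_iff)
  qed
  then show ?thesis by (auto simp: kos_index_def)
qed

lemma kos_index_empty:
  assumes "i < 0 \<or> i > int (k1 + k2)"
  shows "kos_index k1 k2 i = {}"
proof -
  have False if s: "s \<in> kos_index k1 k2 i" for s
  proof -
    obtain A B where AB: "A \<subseteq> {1..k1}" "B \<subseteq> {1..k2}" "int (card A) + int (card B) = i"
      using s by (auto simp: kos_index_def)
    then show False using card_mono[OF _ AB(1)] card_mono[OF _ AB(2)] assms by simp
  qed
  then show ?thesis by blast
qed

text \<open>The two binomial coefficients in the difference operator count the pairs \<open>(A, B)\<close> with given cardinalities, so the operator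
is a sum over the index sets of the complex.\<close>

lemma sum_kos_index:
  fixes f :: "nat \<Rightarrow> nat \<Rightarrow> int"
  shows "(\<Sum>(A, B)\<in>kos_index k1 k2 (int i). f (card A) (card B))
    = (\<Sum>j=0..i. int (k1 choose (i - j)) * int (k2 choose j) * f (i - j) j)"
proof -
  let ?P = "\<lambda>k j. {A. A \<subseteq> {1..k} \<and> card A = j}"
  have fin: "finite (?P k j)" for k j :: nat by (rule finite_subset[of _ "Pow {1..k}"]) auto
  have "kos_index k1 k2 (int i) = (\<Union>j\<in>{0..i}. ?P k1 (i - j) \<times> ?P k2 j)"
    by (auto simp: kos_index_def)
  then have "(\<Sum>(A, B)\<in>kos_index k1 k2 (int i). f (card A) (card B))
      = (\<Sum>j=0..i. \<Sum>(A, B)\<in>?P k1 (i - j) \<times> ?P k2 j. f (card A) (card B))"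
    using fin by (simp only:) (subst sum.UNION_disjoint, auto)
  also have "\<dots> = (\<Sum>j=0..i. \<Sum>(A, B)\<in>?P k1 (i - j) \<times> ?P k2 j. f (i - j) j)"
    by (intro sum.cong) auto
  also have "\<dots> = (\<Sum>j=0..i. int (k1 choose (i - j)) * int (k2 choose j) * f (i - j) j)"
    by (intro sum.cong refl) (simp add: card_cartesian_product n_subsets)
  finally show ?thesis .
qed

lemma bidiff_eq_sum_kos_index:
  "bidiff k1 k2 f n1 n2 = (\<Sum>i=0..k1 + k2. (- 1) ^ i *
    (\<Sum>(A, B)\<in>kos_index k1 k2 (int i). f (n1 - int (card A)) (n2 - int (card B))))"
  unfolding bidiff_def sum_kos_index[of "\<lambda>p q. f (n1 - int p) (n2 - int q)" k1 k2] ..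

section \<open>The Koszul complex and its filtration\<close>

lemma (in cring) koszul_diff_eq_koszul_sum:
  assumes AB: "(A, B) \<in> kos_index k1 k2 (i - 1)"
    and x1: "x1 ` {1..k1} \<subseteq> carrier R" and x2: "x2 ` {1..k2} \<subseteq> carrier R"
    and c: "\<And>s. s \<in> kos_index k1 k2 i \<Longrightarrow> c s \<in> carrier R"
  shows "koszul_diff R k1 k2 x1 x2 i c (A, B) =
    koszul_sum R (concat_seq k1 x1 x2) (k1 + k2) (\<lambda>S. c (split_index k1 k2 S)) (join_index k1 (A, B))"
proof -
  let ?T = "join_index k1 (A, B)" and ?y = "concat_seq k1 x1 x2"
  let ?g = "\<lambda>s. (\<ominus> \<one>) [^] card {t\<in>?T. t < s} \<otimes> ?y s \<otimes> c (split_index k1 k2 (insert s ?T))"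
  let ?sh = "\<lambda>b. b + k1"
  have A: "A \<subseteq> {1..k1}" and B: "B \<subseteq> {1..k2}" using AB by (auto simp: kos_index_def)
  have fin: "finite A" "finite B" using kos_index_finite_sets[OF AB] by auto
  have split: "{1..k1 + k2} - ?T = ({1..k1} - A) \<union> ?sh ` ({1..k2} - B)"
  proof -
    have "s \<in> ?sh ` ({1..k2} - B)" if "s \<in> {1..k1 + k2} - ?T" "s \<notin> {1..k1}" for s
      using that by (intro image_eqI[of _ _ "s - k1"]) (auto simp: join_index_def image_iff)
    moreover have "s \<in> {1..k1} - A" if "s \<in> {1..k1 + k2} - ?T" "s \<in> {1..k1}" for s
      using that by (auto simp: join_index_def)
    moreover have "({1..k1} - A) \<union> ?sh ` ({1..k2} - B) \<subseteq> {1..k1 + k2} - ?T"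
      using A B by (auto simp: join_index_def)
    ultimately show ?thesis by blast
  qed
  have gl: "?g a = (\<ominus> \<one>) [^] card {t\<in>A. t < a} \<otimes> x1 a \<otimes> c (insert a A, B)" if a: "a \<in> {1..k1} - A" for a
  proof -
    have "{t\<in>?T. t < a} = {t\<in>A. t < a}" using a by (auto simp: join_index_def)
    then show ?thesis using a split_insert_left[OF AB, of a] by (simp add: concat_seq_def)
  qed
  have gr: "?g (?sh b) = (\<ominus> \<one>) [^] (card A + card {t\<in>B. t < b}) \<otimes> x2 b \<otimes> c (A, insert b B)"
    if b: "b \<in> {1..k2} - B" for b
  proof -
    have "{t\<in>?T. t < ?sh b} = A \<union> ?sh ` {t\<in>B. t < b}" using A b by (auto simp: join_index_def)
    moreover have "A \<inter> ?sh ` {t\<in>B. t < b} = {}" using A B by fastforce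
    ultimately have "card {t\<in>?T. t < ?sh b} = card A + card {t\<in>B. t < b}"
      using fin by (simp add: card_Un_disjoint card_image)
    then show ?thesis using b split_insert_right[OF AB, of b] by (simp add: concat_seq_def)
  qed
  have cl: "?g a \<in> carrier R" if a: "a \<in> {1..k1} - A" for a
    unfolding gl[OF a] using a x1 c[OF kos_index_insert_left[OF AB a]] by (auto simp: image_subset_iff)
  have cr: "?g (?sh b) \<in> carrier R" if b: "b \<in> {1..k2} - B" for b
    unfolding gr[OF b] using b x2 c[OF kos_index_insert_right[OF AB b]] by (auto simp: image_subset_iff)
  have "koszul_sum R ?y (k1 + k2) (\<lambda>S. c (split_index k1 k2 S)) ?T
      = (\<Oplus>a\<in>{1..k1} - A. ?g a) \<oplus> (\<Oplus>s\<in>?sh ` ({1..k2} - B). ?g s)"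
    unfolding koszul_sum_def split
    using cl cr by (intro finsum_Un_disjoint) auto
  also have "(\<Oplus>s\<in>?sh ` ({1..k2} - B). ?g s) = (\<Oplus>b\<in>{1..k2} - B. ?g (?sh b))"
    using cr by (intro finsum_reindex) auto
  also have "\<dots> = (\<Oplus>b\<in>{1..k2} - B. (\<ominus> \<one>) [^] (card A + card {t\<in>B. t < b}) \<otimes> x2 b \<otimes> c (A, insert b B))"
    using cr gr by (intro finsum_cong') auto
  also have "(\<Oplus>a\<in>{1..k1} - A. ?g a) = (\<Oplus>a\<in>{1..k1} - A. (\<ominus> \<one>) [^] card {t\<in>A. t < a} \<otimes> x1 a \<otimes> c (insert a A, B))"
    using cl gl by (intro finsum_cong') auto
  finally show ?thesis using AB by (simp add: koszul_diff_def)
qed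

locale koszul_filtration = cring R for R (structure) +
  fixes k1 k2 :: nat and x1 x2 :: "nat \<Rightarrow> 'a" and I1 I2 :: "'a set" and n1 n2 :: int
  assumes I1: "ideal I1 R" and I2: "ideal I2 R"
    and x1: "x1 ` {1..k1} \<subseteq> I1" and x2: "x2 ` {1..k2} \<subseteq> I2"
begin

abbreviation "K \<equiv> koszul R k1 k2"
abbreviation "F \<equiv> koszul_filt R k1 k2 I1 I2 n1 n2"
abbreviation "d \<equiv> koszul_diff R k1 k2 x1 x2"
abbreviation "y \<equiv> concat_seq k1 x1 x2"
abbreviation "idx \<equiv> kos_index k1 k2"
abbreviation "flat c \<equiv> (\<lambda>S. c (split_index k1 k2 S))"

text \<open>The preimages in the Koszul complex \<open>K\<close> of the cycles and of the boundaries of the quotient complex \<open>K / F\<close>. Hence \<open>F i \<subseteq> bnd i \<subseteq> cyc i\<close>,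
and the homology of \<open>K / F\<close> is \<open>cyc i / bnd i\<close>.\<close>

definition "cyc i = {c \<in> carrier (K i). d i c \<in> F (i - 1)}"
definition "bnd i = F i <+>\<^bsub>K i\<^esub> d (i + 1) ` carrier (K (i + 1))"

lemma x1_carrier: "x1 ` {1..k1} \<subseteq> carrier R" and x2_carrier: "x2 ` {1..k2} \<subseteq> carrier R"
  using x1 x2 ideal.Icarr[OF I1] ideal.Icarr[OF I2] by blast+

lemma y_carrier:
  assumes "s \<in> {1..k1 + k2}"
  shows "y s \<in> carrier R"
proof (cases "s \<le> k1")
  case True
  then show ?thesis using assms x1_carrier by (auto simp: concat_seq_def image_subset_iff)
next
  case False
  then have "s - k1 \<in> {1..k2}" using assms by auto
  then have "x2 (s - k1) \<in> carrier R" using x2_carrier by blast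
  then show ?thesis using False by (simp add: concat_seq_def)
qed

lemma K_module: "module R (K i)"
  unfolding koszul_eq_pow_module by (rule pow_module)

lemma K_carrier: "carrier (K i) = idx i \<rightarrow>\<^sub>E carrier R"
  by (simp add: koszul_def)

lemma filt_ideal: "ideal (bipow R I1 I2 p q) R"
  by (rule bipow_ideal[OF I1 I2])

lemma F_submodule: "submodule (F i) R (K i)"
  unfolding koszul_eq_pow_module koszul_filt_def
  by (rule PiE_submodule) (auto simp: filt_ideal split: prod.split)

lemma d_flat:
  assumes "c \<in> carrier (K i)" "(A, B) \<in> idx (i - 1)"
  shows "d i c (A, B) = koszul_sum R y (k1 + k2) (flat c) (join_index k1 (A, B))"
  using assms by (intro koszul_diff_eq_koszul_sum x1_carrier x2_carrier) (auto simp: K_carrier)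

lemma flat_carrier:
  assumes "c \<in> carrier (K i)" "(A, B) \<in> idx (i - 1)" "s \<in> {1..k1 + k2} - join_index k1 (A, B)"
  shows "flat c (insert s (join_index k1 (A, B))) \<in> carrier R"
  using split_insert_join_mem[OF assms(2,3)] assms(1) by (auto simp: K_carrier)

lemma d_closed:
  assumes c: "c \<in> carrier (K i)"
  shows "d i c \<in> carrier (K (i - 1))"
proof -
  have "d i c (A, B) \<in> carrier R" if AB: "(A, B) \<in> idx (i - 1)" for A B
    unfolding d_flat[OF c AB] using flat_carrier[OF c AB] y_carrier by (intro koszul_sum_closed) auto
  moreover have "d i c \<in> extensional (idx (i - 1))" by (simp add: koszul_diff_def)
  ultimately show ?thesis by (auto simp: K_carrier PiE_iff)
qed

lemma K_eqI:
  assumes "c \<in> carrier (K i)" "c' \<in> carrier (K i)" "\<And>A B. (A, B) \<in> idx i \<Longrightarrow> c (A, B) = c' (A, B)"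
  shows "c = c'"
  using assms by (intro PiE_ext[of _ "idx i" "\<lambda>_. carrier R"]) (auto simp: K_carrier)

lemma d_linear_map: "linear_map R (K i) (K (i - 1)) (d i)"
proof (intro linear_map.intro linear_map_axioms.intro K_module d_closed)
  interpret K: module R "K i" for i by (rule K_module)
  fix c c' assume c: "c \<in> carrier (K i)" "c' \<in> carrier (K i)"
  show "d i (c \<oplus>\<^bsub>K i\<^esub> c') = d i c \<oplus>\<^bsub>K (i - 1)\<^esub> d i c'"
  proof (rule K_eqI)
    fix A B assume AB: "(A, B) \<in> idx (i - 1)"
    have "d i (c \<oplus>\<^bsub>K i\<^esub> c') (A, B) = koszul_sum R y (k1 + k2) (flat (c \<oplus>\<^bsub>K i\<^esub> c')) (join_index k1 (A, B))"
      using c by (intro d_flat AB) simp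
    also have "\<dots> = koszul_sum R y (k1 + k2) (\<lambda>S. flat c S \<oplus> flat c' S) (join_index k1 (A, B))"
      using split_insert_join_mem[OF AB] y_carrier flat_carrier[OF c(1) AB] flat_carrier[OF c(2) AB]
      by (intro koszul_sum_cong) (auto simp: koszul_def)
    also have "\<dots> = d i c (A, B) \<oplus> d i c' (A, B)"
      unfolding d_flat[OF c(1) AB] d_flat[OF c(2) AB]
      using y_carrier flat_carrier[OF c(1) AB] flat_carrier[OF c(2) AB] by (intro koszul_sum_add) auto
    finally show "d i (c \<oplus>\<^bsub>K i\<^esub> c') (A, B) = (d i c \<oplus>\<^bsub>K (i - 1)\<^esub> d i c') (A, B)"
      using AB by (simp add: koszul_def)
  qed (use c d_closed in auto)
next
  interpret K: module R "K i" for i by (rule K_module)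
  fix r c assume r: "r \<in> carrier R" and c: "c \<in> carrier (K i)"
  show "d i (r \<odot>\<^bsub>K i\<^esub> c) = r \<odot>\<^bsub>K (i - 1)\<^esub> d i c"
  proof (rule K_eqI)
    fix A B assume AB: "(A, B) \<in> idx (i - 1)"
    have "d i (r \<odot>\<^bsub>K i\<^esub> c) (A, B) = koszul_sum R y (k1 + k2) (flat (r \<odot>\<^bsub>K i\<^esub> c)) (join_index k1 (A, B))"
      using r c by (intro d_flat AB) simp
    also have "\<dots> = koszul_sum R y (k1 + k2) (\<lambda>S. r \<otimes> flat c S) (join_index k1 (A, B))"
      using split_insert_join_mem[OF AB] y_carrier flat_carrier[OF c AB] r
      by (intro koszul_sum_cong) (auto simp: koszul_def)
    also have "\<dots> = r \<otimes> d i c (A, B)"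
      unfolding d_flat[OF c AB] using y_carrier flat_carrier[OF c AB] r by (intro koszul_sum_smult) auto
    finally show "d i (r \<odot>\<^bsub>K i\<^esub> c) (A, B) = (r \<odot>\<^bsub>K (i - 1)\<^esub> d i c) (A, B)"
      using AB by (simp add: koszul_def)
  qed (use r c d_closed in auto)
qed

sublocale K: linear_map R "K i" "K (i - 1)" "d i" for i by (rule d_linear_map)

lemma d_d:
  assumes c: "c \<in> carrier (K i)"
  shows "d (i - 1) (d i c) = \<zero>\<^bsub>K (i - 1 - 1)\<^esub>"
proof (rule K_eqI)
  fix A B assume AB: "(A, B) \<in> idx (i - 1 - 1)"
  let ?T = "join_index k1 (A, B)"
  have T: "?T \<subseteq> {1..k1 + k2}" and fT: "finite ?T"
    using join_index_subset[OF AB] finite_subset by auto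
  have flat_d: "flat (d i c) (insert s ?T) = koszul_sum R y (k1 + k2) (flat c) (insert s ?T)"
    if s: "s \<in> {1..k1 + k2} - ?T" for s
  proof -
    obtain A' B' where AB': "split_index k1 k2 (insert s ?T) = (A', B')"
      by (cases "split_index k1 k2 (insert s ?T)")
    then have "(A', B') \<in> idx (i - 1)" using split_insert_join_mem[OF AB s] by simp
    moreover have "join_index k1 (A', B') = insert s ?T"
      unfolding AB'[symmetric] using T s by (intro join_split_index) auto
    ultimately show ?thesis using d_flat[OF c, of A' B'] AB' by simp
  qed
  have fc: "flat c (insert s (insert t ?T)) \<in> carrier R"
    if "s \<in> {1..k1 + k2} - ?T" "t \<in> {1..k1 + k2} - ?T" "s \<noteq> t" for s t
  proof -
    have "int (card (insert s (insert t ?T))) = i"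
      using that fT join_index_card[OF AB] by simp
    then have "split_index k1 k2 (insert s (insert t ?T)) \<in> idx i"
      using that T by (intro split_index_mem) auto
    then show ?thesis using c by (auto simp: K_carrier)
  qed
  have "d (i - 1) (d i c) (A, B) = koszul_sum R y (k1 + k2) (flat (d i c)) ?T"
    by (rule d_flat[OF d_closed[OF c] AB])
  also have "\<dots> = koszul_sum R y (k1 + k2) (koszul_sum R y (k1 + k2) (flat c)) ?T"
    using flat_d flat_carrier[OF d_closed[OF c] AB] y_carrier by (intro koszul_sum_cong) auto
  also have "\<dots> = \<zero>" 
    by (rule koszul_sum_koszul_sum[where c = "flat c", OF T]) (use y_carrier fc in blast)+
  finally show "d (i - 1) (d i c) (A, B) = \<zero>\<^bsub>K (i - 1 - 1)\<^esub> (A, B)"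
    using AB by (simp add: koszul_def)
qed (use d_closed[OF d_closed[OF c]] in simp_all)

lemma F_carrier: "F i \<subseteq> carrier (K i)"
  using K.submodule_subset[OF F_submodule] .

text \<open>Multiplying by \<open>x1 a\<close> makes up for the exponent \<open>n1\<close> lost by passing from \<open>A\<close> to \<open>insert a A\<close>, and likewise for \<open>x2 b\<close>:
the filtration is a subcomplex.\<close>

lemma d_F:
  assumes c: "c \<in> F i"
  shows "d i c \<in> F (i - 1)"
proof -
  have cF: "c (A, B) \<in> bipow R I1 I2 (n1 - int (card A)) (n2 - int (card B))" if "(A, B) \<in> idx i" for A B
    using c that unfolding koszul_filt_def by (auto dest: PiE_mem)
  have "d i c (A, B) \<in> bipow R I1 I2 (n1 - int (card A)) (n2 - int (card B))"
    if AB: "(A, B) \<in> idx (i - 1)" for A B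
  proof -
    let ?J = "bipow R I1 I2 (n1 - int (card A)) (n2 - int (card B))"
    interpret J: ideal ?J R by (rule filt_ideal)
    note fin = kos_index_finite_sets[OF AB]
    have signed: "(\<ominus> \<one>) [^] (p::nat) \<otimes> x \<otimes> z \<in> ?J" if "x \<in> carrier R" "z \<in> carrier R" "x \<otimes> z \<in> ?J" for p x z
      using that J.I_l_closed[OF that(3) sign_closed[of p]] by (simp add: m_assoc)
    have m1: "(\<ominus> \<one>) [^] (p::nat) \<otimes> x1 a \<otimes> c (insert a A, B) \<in> ?J" if a: "a \<in> {1..k1} - A" for a p
    proof (rule signed)
      have "c (insert a A, B) \<in> bipow R I1 I2 (n1 - int (card A) - 1) (n2 - int (card B))"
        using cF[OF kos_index_insert_left[OF AB a]] a fin by (simp add: algebra_simps)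
      then show "x1 a \<otimes> c (insert a A, B) \<in> ?J" using a x1 by (intro bipow_mult_left I1 I2) auto
      show "x1 a \<in> carrier R" "c (insert a A, B) \<in> carrier R"
        using a x1_carrier cF[OF kos_index_insert_left[OF AB a]] ideal.Icarr[OF filt_ideal] by auto
    qed
    have m2: "(\<ominus> \<one>) [^] (p::nat) \<otimes> x2 b \<otimes> c (A, insert b B) \<in> ?J" if b: "b \<in> {1..k2} - B" for b p
    proof (rule signed)
      have "c (A, insert b B) \<in> bipow R I1 I2 (n1 - int (card A)) (n2 - int (card B) - 1)"
        using cF[OF kos_index_insert_right[OF AB b]] b fin by (simp add: algebra_simps)
      then show "x2 b \<otimes> c (A, insert b B) \<in> ?J" using b x2 by (intro bipow_mult_right I1 I2) auto
      show "x2 b \<in> carrier R" "c (A, insert b B) \<in> carrier R"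
        using b x2_carrier cF[OF kos_index_insert_right[OF AB b]] ideal.Icarr[OF filt_ideal] by auto
    qed
    have "d i c (A, B) =
        (\<Oplus>a\<in>{1..k1} - A. (\<ominus> \<one>) [^] card {t\<in>A. t < a} \<otimes> x1 a \<otimes> c (insert a A, B)) \<oplus>
        (\<Oplus>b\<in>{1..k2} - B. (\<ominus> \<one>) [^] (card A + card {t\<in>B. t < b}) \<otimes> x2 b \<otimes> c (A, insert b B))"
      using AB by (simp add: koszul_diff_def)
    also have "\<dots> \<in> ?J" by (intro J.a_closed ideal_finsum_closed[OF filt_ideal] m1 m2)
    finally show ?thesis .
  qed
  moreover have "d i c \<in> extensional (idx (i - 1))" by (simp add: koszul_diff_def)
  ultimately show ?thesis unfolding koszul_filt_def by (auto simp: PiE_iff)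
qed

lemma cyc_submodule: "submodule (cyc i) R (K i)"
  unfolding cyc_def by (rule K.preimage_submodule[OF F_submodule])

lemma dK_submodule: "submodule (d (i + 1) ` carrier (K (i + 1))) R (K i)"
  using K.image_submodule[OF K.carrier_is_submodule, of "i + 1"] by simp

lemma bnd_submodule: "submodule (bnd i) R (K i)"
  unfolding bnd_def by (rule K.submodule_set_add[OF F_submodule dK_submodule])

lemma F_subset_bnd: "F i \<subseteq> bnd i" and dK_subset_bnd: "d (i + 1) ` carrier (K (i + 1)) \<subseteq> bnd i"
  unfolding bnd_def using K.set_add_subset_left K.set_add_subset_right F_submodule dK_submodule by blast+

lemma bnd_subset_cyc: "bnd i \<subseteq> cyc i"
  unfolding bnd_def
proof (rule K.set_add_least[OF cyc_submodule])
  show "F i \<subseteq> cyc i" using d_F F_carrier by (auto simp: cyc_def)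
  have "d i (d (i + 1) c) = \<zero>\<^bsub>K (i - 1)\<^esub>" "d (i + 1) c \<in> carrier (K i)"
    if "c \<in> carrier (K (i + 1))" for c
    using d_d[OF that] d_closed[OF that] by simp_all
  then show "d (i + 1) ` carrier (K (i + 1)) \<subseteq> cyc i"
    using K.submodule_zero[OF F_submodule] by (auto simp: cyc_def)
qed

abbreviation "coset i \<equiv> (\<lambda>c. F i +>\<^bsub>K i\<^esub> c)"

lemma C_diff_coset:
  assumes c: "c \<in> carrier (K i)"
  shows "C_diff R k1 k2 x1 x2 I1 I2 n1 n2 i (coset i c) = coset (i - 1) (d i c)"
proof -
  have "coset (i - 1) (d i u) = coset (i - 1) (d i c)" if u: "u \<in> coset i c" for u
  proof -
    obtain f where f: "f \<in> F i" "u = f \<oplus>\<^bsub>K i\<^esub> c" using u by (auto simp: a_r_coset_def')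
    have fK: "f \<in> carrier (K i)" using f F_carrier by auto
    have "d i u = d i f \<oplus>\<^bsub>K (i - 1)\<^esub> d i c" using f fK c K.add by simp
    then have "d i u \<ominus>\<^bsub>K (i - 1)\<^esub> d i c = d i f"
      using d_closed[OF fK] d_closed[OF c] by (simp add: a_minus_def K.M.a_assoc K.M.r_neg)
    then show ?thesis
      using coset_eq_iff[OF K_module F_submodule, of "d i u" "i - 1" "d i c"] d_F[OF f(1)] d_closed fK c f(2)
      by simp
  qed
  moreover have "c \<in> coset i c"
    using abelian_subgroup.a_rcos_self[OF submodule_abelian_subgroup[OF K_module F_submodule] c] .
  ultimately have "(\<lambda>u. coset (i - 1) (d i u)) ` coset i c = {coset (i - 1) (d i c)}" by blast
  then show ?thesis by (simp add: C_diff_def)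
qed

lemma C_mod_carrier: "carrier (C_mod R k1 k2 I1 I2 n1 n2 i) = coset i ` carrier (K i)"
  by (auto simp: C_mod_def quot_module_def A_RCOSETS_def')

lemma coset_eq_zero_iff:
  assumes "c \<in> carrier (K i)"
  shows "coset i c = F i \<longleftrightarrow> c \<in> F i"
proof -
  have "coset i \<zero>\<^bsub>K i\<^esub> = F i" using F_carrier by simp
  then show ?thesis
    using coset_eq_iff[OF K_module F_submodule assms K.M.zero_closed] assms K.M.minus_equality[OF K.M.l_zero[OF K.M.zero_closed] K.M.zero_closed K.M.zero_closed]
    by (simp add: a_minus_def)
qed

text \<open>On cosets the differential of \<open>K / F\<close> is induced by \<open>d\<close>, so its kernel and image consist of the cosets of \<open>cyc i\<close> and \<open>bnd i\<close>.\<close>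

theorem module_length_C_homology:
  "module_length R (C_homology R k1 k2 x1 x2 I1 I2 n1 n2 i) = interval_length R (K i) (bnd i) (cyc i)"
proof -
  have ker: "a_kernel (C_mod R k1 k2 I1 I2 n1 n2 i) (C_mod R k1 k2 I1 I2 n1 n2 (i - 1))
      (C_diff R k1 k2 x1 x2 I1 I2 n1 n2 i) = coset i ` cyc i"
  proof -
    have zero: "\<zero>\<^bsub>C_mod R k1 k2 I1 I2 n1 n2 (i - 1)\<^esub> = F (i - 1)" by (simp add: C_mod_def quot_module_def)
    have "C_diff R k1 k2 x1 x2 I1 I2 n1 n2 i (coset i c) = F (i - 1) \<longleftrightarrow> d i c \<in> F (i - 1)"
      if "c \<in> carrier (K i)" for c
      unfolding C_diff_coset[OF that] by (rule coset_eq_zero_iff[OF d_closed[OF that]])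
    then show ?thesis unfolding a_kernel_def' C_mod_carrier zero cyc_def by blast
  qed
  have im: "C_diff R k1 k2 x1 x2 I1 I2 n1 n2 (i + 1) ` carrier (C_mod R k1 k2 I1 I2 n1 n2 (i + 1))
      = coset i ` bnd i"
  proof -
    have "coset i (f \<oplus>\<^bsub>K i\<^esub> c) = coset i c" if f: "f \<in> F i" and c: "c \<in> carrier (K i)" for f c
    proof -
      have fK: "f \<in> carrier (K i)" using f F_carrier by auto
      then have "(f \<oplus>\<^bsub>K i\<^esub> c) \<ominus>\<^bsub>K i\<^esub> c = f" using c by (simp add: a_minus_def K.M.a_assoc K.M.r_neg)
      then show ?thesis using coset_eq_iff[OF K_module F_submodule, of "f \<oplus>\<^bsub>K i\<^esub> c" i c] fK c f by simp
    qed
    moreover have dK: "d (i + 1) c \<in> carrier (K i)" if "c \<in> carrier (K (i + 1))" for c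
      using d_closed[OF that] by simp
    ultimately have "coset i ` bnd i \<subseteq> coset i ` d (i + 1) ` carrier (K (i + 1))"
      unfolding bnd_def set_add_def' by blast
    moreover have "coset i ` d (i + 1) ` carrier (K (i + 1)) \<subseteq> coset i ` bnd i"
      using dK_subset_bnd by (intro image_mono)
    moreover have "C_diff R k1 k2 x1 x2 I1 I2 n1 n2 (i + 1) ` coset (i + 1) ` carrier (K (i + 1))
        = coset i ` d (i + 1) ` carrier (K (i + 1))"
      unfolding image_image using C_diff_coset[of _ "i + 1"] by (intro image_cong) auto
    ultimately show ?thesis by (simp add: C_mod_carrier)
  qed
  show ?thesis
    unfolding C_homology_def ker im unfolding C_mod_def
    by (rule module_length_subquotient_of_quotient[OF K_module F_submodule bnd_submodule cyc_submodule
          F_subset_bnd bnd_subset_cyc])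
qed

end


lemma (in module) interval_length_additive_int:
  assumes "submodule A R M" "submodule B R M" "submodule C R M" "A \<subseteq> B" "B \<subseteq> C"
    and fin: "interval_length R M A C \<noteq> \<infinity>"
  shows "int (the_enat (interval_length R M A C))
    = int (the_enat (interval_length R M A B)) + int (the_enat (interval_length R M B C))"
    and "interval_length R M A B \<noteq> \<infinity>" "interval_length R M B C \<noteq> \<infinity>"
proof -
  have eq: "interval_length R M A C = interval_length R M A B + interval_length R M B C"
    using assms by (intro interval_length_additive)
  show f: "interval_length R M A B \<noteq> \<infinity>" "interval_length R M B C \<noteq> \<infinity>"
    using fin unfolding eq by (metis plus_enat_simps(2), metis plus_enat_simps(3))
  then show "int (the_enat (interval_length R M A C))
    = int (the_enat (interval_length R M A B)) + int (the_enat (interval_length R M B C))"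
    unfolding eq by auto
qed

lemma the_enat_sum:
  assumes "finite S" "\<And>s. s \<in> S \<Longrightarrow> f s \<noteq> (\<infinity>::enat)"
  shows "(\<Sum>s\<in>S. f s) \<noteq> \<infinity> \<and> int (the_enat (\<Sum>s\<in>S. f s)) = (\<Sum>s\<in>S. int (the_enat (f s)))"
  using assms
proof (induction S rule: finite_induct)
  case (insert x S)
  then obtain p q where "f x = enat p" "sum f S = enat q" by (metis insertI1 insertI2 not_infinity_eq)
  then show ?case using insert by simp
qed (simp add: zero_enat_def)

section \<open>The Euler characteristic\<close>

lemma alternating_sum_telescope:
  fixes a h L :: "int \<Rightarrow> int"
  assumes "\<And>i. L i = a i + h i + a (i - 1)"
  shows "(\<Sum>i=0..n. (- 1) ^ i * L (int i)) = (\<Sum>i=0..n. (- 1) ^ i * h (int i)) + (- 1) ^ n * a (int n) + a (- 1)"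
proof (induction n)
  case 0
  then show ?case using assms[of 0] by simp
next
  case (Suc n)
  have "L (int (Suc n)) = a (int (Suc n)) + h (int (Suc n)) + a (int n)"
    using assms[of "int (Suc n)"] by simp
  then show ?case using Suc by (simp add: algebra_simps)
qed

context koszul_filtration begin

text \<open>At both ends of the complex nothing is added to \<open>F i\<close>: either there is nothing above degree \<open>i\<close> to map from, or degree
\<open>i\<close> itself is zero. These are the boundary terms of the telescoping sum.\<close>

lemma bnd_eq_F:
  assumes "idx i = {} \<or> idx (i + 1) = {}"
  shows "bnd i = F i"
proof
  have trivial: "carrier (K j) = F j" if "idx j = {}" for j
    using that by (simp add: K_carrier koszul_filt_def)
  show "bnd i \<subseteq> F i"
  proof (cases "idx i = {}")
    case True
    then show ?thesis using K.submodule_subset[OF bnd_submodule] trivial by metis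
  next
    case False
    then have "carrier (K (i + 1)) = F (i + 1)" using assms by (intro trivial) simp
    then have "d (i + 1) ` carrier (K (i + 1)) \<subseteq> F i" using d_F[of _ "i + 1"] by auto
    then show ?thesis unfolding bnd_def by (intro K.set_add_least F_submodule) auto
  qed
qed (rule F_subset_bnd)

text \<open>The differential identifies the chains modulo cycles in degree \<open>i\<close> with the boundaries in degree \<open>i - 1\<close>.\<close>

lemma interval_length_cyc:
  "interval_length R (K i) (cyc i) (carrier (K i)) = interval_length R (K (i - 1)) (F (i - 1)) (bnd (i - 1))"
proof -
  have bnd: "bnd (i - 1) = F (i - 1) <+>\<^bsub>K (i - 1)\<^esub> d i ` carrier (K i)"
    using bnd_def[of "i - 1"] by simp
  have "{c \<in> carrier (K i). d i c \<in> bnd (i - 1)} = carrier (K i)"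
    using dK_subset_bnd[of "i - 1"] by auto
  then show ?thesis
    using K.interval_length_preimage[OF F_submodule bnd_submodule F_subset_bnd, of i] bnd
    unfolding cyc_def by simp
qed

lemma interval_length_F:
  "interval_length R (K i) (F i) (carrier (K i)) = (\<Sum>(A, B)\<in>idx i.
     interval_length R (self_module R) (bipow R I1 I2 (n1 - int (card A)) (n2 - int (card B))) (carrier R))"
proof -
  let ?J = "\<lambda>s. case s of (A, B) \<Rightarrow> bipow R I1 I2 (n1 - int (card A)) (n2 - int (card B))"
  have "interval_length R (K i) (F i) (carrier (K i)) = (\<Sum>s\<in>idx i. interval_length R (self_module R) (?J s) (carrier R))"
    unfolding koszul_eq_pow_module koszul_filt_def
    by (rule interval_length_PiE[OF finite_kos_index]) (auto simp: filt_ideal split: prod.split)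
  also have "\<dots> = (\<Sum>(A, B)\<in>idx i. interval_length R (self_module R) (bipow R I1 I2 (n1 - int (card A)) (n2 - int (card B))) (carrier R))"
    by (intro sum.cong) auto
  finally show ?thesis .
qed

lemma hilb_eq: "hilb R I1 I2 p q = int (the_enat (interval_length R (self_module R) (bipow R I1 I2 p q) (carrier R)))"
  unfolding hilb_def len_def
  using ideal.axioms(1)[OF filt_ideal, THEN additive_subgroup.a_subset]
  by (subst module_length_ideal_quot) (auto simp: filt_ideal oneideal)

lemma koszul_h_eq:
  "koszul_h R k1 k2 x1 x2 I1 I2 n1 n2 i = int (the_enat (interval_length R (K i) (bnd i) (cyc i)))"
  unfolding koszul_h_def len_def module_length_C_homology ..

text \<open>With \<open>a i\<close> the length of the boundaries and \<open>h i\<close> that of the homology, the length of the degree \<open>i\<close> term is \<open>a i + h i + a (i - 1)\<close>.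
In the alternating sum the \<open>a i\<close> cancel, and the left-hand side is the iterated difference
because the terms are direct sums of rings \<open>R / I1\<^sup>p I2\<^sup>q\<close>. Finite length is essential: otherwise the
cancellation would subtract infinities.\<close>

theorem bidiff_hilb_eq_euler_characteristic:
  assumes fin: "\<And>p q. interval_length R (self_module R) (bipow R I1 I2 p q) (carrier R) \<noteq> \<infinity>"
  shows "bidiff k1 k2 (hilb R I1 I2) n1 n2
    = (\<Sum>i=0..k1 + k2. (- 1) ^ i * koszul_h R k1 k2 x1 x2 I1 I2 n1 n2 (int i))"
proof -
  let ?len = "\<lambda>i. interval_length R (K i) (F i) (carrier (K i))"
  define L where "L i = int (the_enat (?len i))" for i
  define a where "a i = int (the_enat (interval_length R (K i) (F i) (bnd i)))" for i
  let ?h = "koszul_h R k1 k2 x1 x2 I1 I2 n1 n2"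
  have L: "?len i \<noteq> \<infinity> \<and> L i = (\<Sum>(A, B)\<in>idx i. hilb R I1 I2 (n1 - int (card A)) (n2 - int (card B)))" for i
    unfolding L_def interval_length_F hilb_eq
    using the_enat_sum[OF finite_kos_index, of k1 k2 i "\<lambda>(A, B). interval_length R (self_module R)
      (bipow R I1 I2 (n1 - int (card A)) (n2 - int (card B))) (carrier R)"] fin
    by (auto simp: case_prod_unfold)
  have "L i = a i + ?h i + a (i - 1)" for i
  proof -
    note add1 = K.interval_length_additive_int[OF F_submodule bnd_submodule K.carrier_is_submodule
        F_subset_bnd K.submodule_subset[OF bnd_submodule], of i]
    note add2 = K.interval_length_additive_int[OF bnd_submodule cyc_submodule K.carrier_is_submodule
        bnd_subset_cyc K.submodule_subset[OF cyc_submodule], of i]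
    have f: "?len i \<noteq> \<infinity>" using L by blast
    show ?thesis
      using add1(1)[OF f] add2(1)[OF add1(3)[OF f]]
      by (simp add: L_def a_def koszul_h_eq interval_length_cyc)
  qed
  then have "(\<Sum>i=0..k1 + k2. (- 1) ^ i * L (int i))
      = (\<Sum>i=0..k1 + k2. (- 1) ^ i * ?h (int i)) + (- 1) ^ (k1 + k2) * a (int (k1 + k2)) + a (- 1)"
    by (rule alternating_sum_telescope)
  moreover have "a (int (k1 + k2)) = 0" "a (- 1) = 0"
    unfolding a_def by (subst bnd_eq_F; simp add: kos_index_empty interval_length_refl zero_enat_def)+
  ultimately show ?thesis using L by (simp add: bidiff_eq_sum_kos_index)
qed

section \<open>Homology in degrees zero and one\<close>

abbreviation "X1 \<equiv> Idl (x1 ` {1..k1})"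
abbreviation "X2 \<equiv> Idl (x2 ` {1..k2})"
abbreviation "U \<equiv> bipow R I1 I2 n1 n2"
abbreviation "V \<equiv> (X1 \<cdot> bipow R I1 I2 (n1 - 1) n2) <+>\<^bsub>R\<^esub> (X2 \<cdot> bipow R I1 I2 n1 (n2 - 1))"
abbreviation "X \<equiv> X1 <+>\<^bsub>R\<^esub> X2"

text \<open>The differential \<open>K\<^sub>1 \<rightarrow> K\<^sub>0\<close> with \<open>K\<^sub>0\<close> identified with \<open>R\<close> by the coordinate at \<open>({}, {})\<close>.\<close>

definition "aug c = d 1 c ({}, {})"

lemma eval_linear: "linear_map R (K 0) (self_module R) (\<lambda>c. c ({}, {}))"
  unfolding koszul_eq_pow_module by (rule eval_linear_map) (simp add: kos_index_0)

lemma aug_linear: "linear_map R (K 1) (self_module R) aug"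
proof -
  interpret eval: linear_map R "K 0" "self_module R" "\<lambda>c. c ({}, {})" by (rule eval_linear)
  show ?thesis
    using K.closed[of _ 1] K.add[of _ 1] K.smult[of _ _ 1] eval.closed eval.add eval.smult
    by (intro linear_map.intro linear_map_axioms.intro K_module self_module) (simp_all add: aug_def)
qed

sublocale eval: linear_map R "K 0" "self_module R" "\<lambda>c. c ({}, {})" by (rule eval_linear)

sublocale aug: linear_map R "K 1" "self_module R" aug by (rule aug_linear)

lemma K0_eqI:
  "c \<in> carrier (K 0) \<Longrightarrow> c' \<in> carrier (K 0) \<Longrightarrow> c ({}, {}) = c' ({}, {}) \<Longrightarrow> c = c'"
  by (rule K_eqI) (auto simp: kos_index_0)

lemma F0_iff: "c \<in> carrier (K 0) \<Longrightarrow> c \<in> F 0 \<longleftrightarrow> c ({}, {}) \<in> U"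
  by (auto simp: koszul_filt_def K_carrier PiE_iff kos_index_0)

lemma aug_eq:
  assumes "c \<in> carrier (K 1)"
  shows "aug c = (\<Oplus>a\<in>{1..k1}. x1 a \<otimes> c ({a}, {})) \<oplus> (\<Oplus>b\<in>{1..k2}. x2 b \<otimes> c ({}, {b}))"
proof -
  have c: "c ({a}, {}) \<in> carrier R" if "a \<in> {1..k1}" for a
    using assms that by (auto simp: K_carrier kos_index_1)
  have c': "c ({}, {b}) \<in> carrier R" if "b \<in> {1..k2}" for b
    using assms that by (auto simp: K_carrier kos_index_1)
  have x: "x1 a \<in> carrier R" if "a \<in> {1..k1}" for a using that x1_carrier by blast
  have x': "x2 b \<in> carrier R" if "b \<in> {1..k2}" for b using that x2_carrier by blast
  have "aug c = (\<Oplus>a\<in>{1..k1}. \<one> \<otimes> x1 a \<otimes> c ({a}, {})) \<oplus> (\<Oplus>b\<in>{1..k2}. \<one> \<otimes> x2 b \<otimes> c ({}, {b}))"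
    by (simp add: aug_def koszul_diff_def kos_index_0)
  also have "(\<Oplus>a\<in>{1..k1}. \<one> \<otimes> x1 a \<otimes> c ({a}, {})) = (\<Oplus>a\<in>{1..k1}. x1 a \<otimes> c ({a}, {}))"
    using c x by (intro finsum_cong') auto
  also have "(\<Oplus>b\<in>{1..k2}. \<one> \<otimes> x2 b \<otimes> c ({}, {b})) = (\<Oplus>b\<in>{1..k2}. x2 b \<otimes> c ({}, {b}))"
    using c' x' by (intro finsum_cong') auto
  finally show ?thesis .
qed

text \<open>Chains of degree one with prescribed coefficient ideals. This covers both \<open>K\<^sub>1\<close> and \<open>F\<^sub>1\<close>, so that one computation of
images yields the ideal generated by the sequence as well as the denominator of the second length in the theorem.\<close>

definition "deg1 J1 J2 = {c \<in> carrier (K 1). (\<forall>a\<in>{1..k1}. c ({a}, {}) \<in> J1) \<and> (\<forall>b\<in>{1..k2}. c ({}, {b}) \<in> J2)}"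

lemma deg1_carrier: "deg1 (carrier R) (carrier R) = carrier (K 1)"
  by (auto simp: deg1_def K_carrier kos_index_1)

lemma deg1_F: "deg1 (bipow R I1 I2 (n1 - 1) n2) (bipow R I1 I2 n1 (n2 - 1)) = F 1"
proof -
  have "c \<in> deg1 (bipow R I1 I2 (n1 - 1) n2) (bipow R I1 I2 n1 (n2 - 1)) \<longleftrightarrow> c \<in> F 1"
    if "c \<in> carrier (K 1)" for c
    using that by (auto simp: deg1_def K_carrier koszul_filt_def PiE_iff kos_index_1 ball_Un)
  then show ?thesis using F_carrier[of 1] by (auto simp: deg1_def)
qed

lemma aug_deg1:
  assumes J: "ideal J1 R" "ideal J2 R"
  shows "aug ` deg1 J1 J2 = (X1 \<cdot> J1) <+>\<^bsub>R\<^esub> (X2 \<cdot> J2)"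
proof -
  have prods: "X1 \<cdot> J1 = lincombs R x1 {1..k1} J1" "X2 \<cdot> J2 = lincombs R x2 {1..k2} J2"
    by (rule genideal_prod_eq_lincombs[OF finite_atLeastAtMost x1_carrier J(1)],
        rule genideal_prod_eq_lincombs[OF finite_atLeastAtMost x2_carrier J(2)])
  show ?thesis
  proof
    have "aug c \<in> lincombs R x1 {1..k1} J1 <+>\<^bsub>R\<^esub> lincombs R x2 {1..k2} J2" if c: "c \<in> deg1 J1 J2" for c
    proof -
      have "(\<Oplus>a\<in>{1..k1}. x1 a \<otimes> c ({a}, {})) \<in> lincombs R x1 {1..k1} J1"
        using c unfolding lincombs_def deg1_def by (auto intro!: exI[of _ "\<lambda>a. c ({a}, {})"])
      moreover have "(\<Oplus>b\<in>{1..k2}. x2 b \<otimes> c ({}, {b})) \<in> lincombs R x2 {1..k2} J2"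
        using c unfolding lincombs_def deg1_def by (auto intro!: exI[of _ "\<lambda>b. c ({}, {b})"])
      moreover have "c \<in> carrier (K 1)" using c by (simp add: deg1_def)
      ultimately show ?thesis unfolding set_add_def' by (auto simp: aug_eq)
    qed
    then show "aug ` deg1 J1 J2 \<subseteq> (X1 \<cdot> J1) <+>\<^bsub>R\<^esub> (X2 \<cdot> J2)" unfolding prods by blast
    show "(X1 \<cdot> J1) <+>\<^bsub>R\<^esub> (X2 \<cdot> J2) \<subseteq> aug ` deg1 J1 J2"
    proof
      fix v assume "v \<in> (X1 \<cdot> J1) <+>\<^bsub>R\<^esub> (X2 \<cdot> J2)"
      then obtain p q where pq: "p \<in> {1..k1} \<rightarrow> J1" "q \<in> {1..k2} \<rightarrow> J2"
        "v = (\<Oplus>a\<in>{1..k1}. x1 a \<otimes> p a) \<oplus> (\<Oplus>b\<in>{1..k2}. x2 b \<otimes> q b)"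
        unfolding prods lincombs_def set_add_def' by blast
      let ?c = "\<lambda>(A, B)\<in>idx 1. if B = {} then p (the_elem A) else q (the_elem B)"
      have cp: "?c ({a}, {}) = p a" if "a \<in> {1..k1}" for a using that by (auto simp: kos_index_1)
      have cq: "?c ({}, {b}) = q b" if "b \<in> {1..k2}" for b using that by (auto simp: kos_index_1)
      have p: "p a \<in> J1" "p a \<in> carrier R" "x1 a \<in> carrier R" if "a \<in> {1..k1}" for a
        using Pi_mem[OF pq(1) that] ideal.Icarr[OF J(1) Pi_mem[OF pq(1) that]] x1_carrier that by blast+
      have q: "q b \<in> J2" "q b \<in> carrier R" "x2 b \<in> carrier R" if "b \<in> {1..k2}" for b
        using Pi_mem[OF pq(2) that] ideal.Icarr[OF J(2) Pi_mem[OF pq(2) that]] x2_carrier that by blast+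
      have cK: "?c \<in> carrier (K 1)" unfolding K_carrier
      proof (rule PiE_I)
        fix s assume s: "s \<in> idx 1"
        then show "?c s \<in> carrier R" using cp cq p(2) q(2) unfolding kos_index_1 by fastforce
      qed simp
      then have cd: "?c \<in> deg1 J1 J2" using cp cq p(1) q(1) by (simp add: deg1_def)
      have "(\<Oplus>a\<in>{1..k1}. x1 a \<otimes> ?c ({a}, {})) = (\<Oplus>a\<in>{1..k1}. x1 a \<otimes> p a)"
        using cp p by (intro finsum_cong') auto
      moreover have "(\<Oplus>b\<in>{1..k2}. x2 b \<otimes> ?c ({}, {b})) = (\<Oplus>b\<in>{1..k2}. x2 b \<otimes> q b)"
        using cq q by (intro finsum_cong') auto
      ultimately have "aug ?c = v" using aug_eq[OF cK] pq(3) by simp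
      then show "v \<in> aug ` deg1 J1 J2" using cd by blast
    qed
  qed
qed

lemma X_ideals: "ideal X1 R" "ideal X2 R"
  by (intro genideal_ideal x1_carrier x2_carrier)+

lemma aug_image: "aug ` carrier (K 1) = X"
  using aug_deg1[OF oneideal oneideal] X_ideals by (simp add: deg1_carrier ideal_prod_one)

lemma aug_F: "aug ` F 1 = V"
  unfolding deg1_F[symmetric] by (rule aug_deg1[OF filt_ideal filt_ideal])

lemma X_ideal: "ideal X R"
  using X_ideals by (rule add_ideals)

lemma V_ideal: "ideal V R"
  by (intro add_ideals ideal_prod_is_ideal X_ideals filt_ideal)

lemma d_1_closed: "c \<in> carrier (K 1) \<Longrightarrow> d 1 c \<in> carrier (K 0)"
  using d_closed[of c 1] by simp

text \<open>\<open>K\<^sub>0 / F\<^sub>0\<close> is \<open>R / U\<close>, every element is a cycle, and the boundaries are the image of the ideal \<open>X\<close> generated by both sequences.\<close>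

theorem interval_length_homology_0:
  "interval_length R (K 0) (bnd 0) (cyc 0) = interval_length R (self_module R) (U <+>\<^bsub>R\<^esub> X) (carrier R)"
proof -
  have UX: "ideal (U <+>\<^bsub>R\<^esub> X) R" by (intro add_ideals filt_ideal X_ideal)
  have const: "(\<lambda>s\<in>idx 0. r) \<in> carrier (K 0)" if "r \<in> carrier R" for r
    using that by (simp add: K_carrier)
  have surj: "carrier R \<subseteq> (\<lambda>c. c ({}, {})) ` carrier (K 0)"
  proof
    fix r assume "r \<in> carrier R"
    then show "r \<in> (\<lambda>c. c ({}, {})) ` carrier (K 0)"
      by (intro image_eqI[OF _ const]) (simp_all add: kos_index_0)
  qed
  have idx_neg: "idx (0 - 1) = {}" by (rule kos_index_empty) simp
  have cyc: "cyc 0 = {c \<in> carrier (K 0). c ({}, {}) \<in> carrier R}"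
    using d_closed[of _ 0] idx_neg eval.closed by (auto simp: cyc_def koszul_filt_def K_carrier self_module_def)
  have bnd: "bnd 0 = {c \<in> carrier (K 0). c ({}, {}) \<in> U <+>\<^bsub>R\<^esub> X}"
  proof
    show "bnd 0 \<subseteq> {c \<in> carrier (K 0). c ({}, {}) \<in> U <+>\<^bsub>R\<^esub> X}"
    proof
      fix c assume c: "c \<in> bnd 0"
      then obtain f w where fw: "f \<in> F 0" "w \<in> carrier (K 1)" "c = f \<oplus>\<^bsub>K 0\<^esub> d 1 w"
        by (auto simp: bnd_def set_add_def')
      have fK: "f \<in> carrier (K 0)" using fw F_carrier by auto
      have "c ({}, {}) = f ({}, {}) \<oplus> aug w"
        using eval.add[OF fK d_1_closed[OF fw(2)]] fw(3) by (simp add: aug_def self_module_def)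
      moreover have "f ({}, {}) \<in> U" using F0_iff[OF fK] fw by simp
      moreover have "aug w \<in> X" using aug_image fw by blast
      ultimately have "c ({}, {}) \<in> U <+>\<^bsub>R\<^esub> X" unfolding set_add_def'[of R U X] by blast
      moreover have "c \<in> carrier (K 0)" using c K.submodule_subset[OF bnd_submodule] by blast
      ultimately show "c \<in> {c \<in> carrier (K 0). c ({}, {}) \<in> U <+>\<^bsub>R\<^esub> X}" by simp
    qed
    show "{c \<in> carrier (K 0). c ({}, {}) \<in> U <+>\<^bsub>R\<^esub> X} \<subseteq> bnd 0"
    proof
      fix c assume "c \<in> {c \<in> carrier (K 0). c ({}, {}) \<in> U <+>\<^bsub>R\<^esub> X}"
      then obtain u w where c: "c \<in> carrier (K 0)" "c ({}, {}) = u \<oplus> aug w" "u \<in> U" "w \<in> carrier (K 1)"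
        unfolding aug_image[symmetric] by (auto simp: set_add_def')
      let ?f = "\<lambda>s\<in>idx 0. u"
      have uR: "u \<in> carrier R" using c(3) ideal.Icarr[OF filt_ideal] by blast
      have f: "?f \<in> F 0" using F0_iff[OF const[OF uR]] c(3) by (simp add: kos_index_0)
      have "c = ?f \<oplus>\<^bsub>K 0\<^esub> d 1 w"
      proof (rule K0_eqI[OF c(1)])
        show "?f \<oplus>\<^bsub>K 0\<^esub> d 1 w \<in> carrier (K 0)" using const[OF uR] d_1_closed[OF c(4)] by (rule K.M.a_closed)
        show "c ({}, {}) = (?f \<oplus>\<^bsub>K 0\<^esub> d 1 w) ({}, {})"
          using eval.add[OF const[OF uR] d_1_closed[OF c(4)]] c(2)
          by (simp add: aug_def self_module_def kos_index_0)
      qed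
      then show "c \<in> bnd 0" using f c(4) by (auto simp: bnd_def set_add_def')
    qed
  qed
  show ?thesis
    unfolding bnd cyc
  proof (rule eval.interval_length_preimage[symmetric])
    show sub: "submodule (U <+>\<^bsub>R\<^esub> X) R (self_module R)" "submodule (carrier R) R (self_module R)"
      using UX oneideal by (auto simp: submodule_self_iff)
    show "U <+>\<^bsub>R\<^esub> X \<subseteq> carrier R" using ideal.axioms(1)[OF UX] by (rule additive_subgroup.a_subset)
    show "carrier R \<subseteq> (U <+>\<^bsub>R\<^esub> X) <+>\<^bsub>self_module R\<^esub> (\<lambda>c. c ({}, {})) ` carrier (K 0)"
      using surj eval.N.set_add_subset_right[OF sub(1) eval.image_submodule[OF K.carrier_is_submodule]] by blast
  qed
qed

text \<open>A one-cycle is a syzygy of the sequence. The syzygy theorem provides its coefficients as a function on subsets,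
which the index bijection turns into a chain of degree two.\<close>

lemma koszul_exact_1:
  assumes reg: "regular_sequence R (k1 + k2) y" and c: "c \<in> carrier (K 1)" and 0: "aug c = \<zero>"
  shows "\<exists>w\<in>carrier (K 2). d 2 w = c"
proof -
  let ?k = "k1 + k2"
  let ?c = "\<lambda>s. c (split_index k1 k2 {s})"
  have split: "split_index k1 k2 {s} \<in> idx 1" if "s \<in> {1..?k}" for s
    using that by (intro split_index_mem) auto
  have cR: "?c s \<in> carrier R" if "s \<in> {1..?k}" for s using c split[OF that] by (auto simp: K_carrier)
  have "(\<Oplus>s\<in>{1..?k}. y s \<otimes> ?c s) = koszul_sum R y ?k (flat c) {}"
    unfolding koszul_sum_def using cR y_carrier by (intro finsum_cong') auto
  also have "\<dots> = aug c"
    using d_flat[OF c, of "{}" "{}"] by (simp add: aug_def kos_index_0 join_index_def)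
  finally have "(\<Oplus>s\<in>{1..?k}. y s \<otimes> ?c s) = \<zero>" using 0 by simp
  moreover have "y ` {1..?k} \<subseteq> carrier R" using y_carrier by blast
  moreover have "\<And>i r. i \<in> {1..?k} \<Longrightarrow> r \<in> carrier R \<Longrightarrow> y i \<otimes> r \<in> Idl (y ` {1..<i}) \<Longrightarrow> r \<in> Idl (y ` {1..<i})"
    using reg unfolding regular_sequence_def by blast
  ultimately have "\<exists>b. (\<forall>S. b S \<in> carrier R) \<and> (\<forall>s\<in>{1..?k}. koszul_sum R y ?k b {s} = ?c s)"
    using cR by (intro regular_sequence_syzygy)
  then obtain b where b: "\<And>S. b S \<in> carrier R" "\<And>s. s \<in> {1..?k} \<Longrightarrow> koszul_sum R y ?k b {s} = ?c s"
    by blast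
  let ?w = "\<lambda>s\<in>idx 2. b (join_index k1 s)"
  have w: "?w \<in> carrier (K 2)" using b(1) by (simp add: K_carrier)
  have "d 2 ?w = c"
  proof (rule K_eqI[of _ 1])
    fix A B assume AB: "(A, B) \<in> idx 1"
    then have AB': "(A, B) \<in> idx (2 - 1)" by simp
    let ?T = "join_index k1 (A, B)"
    have "card ?T = 1" using join_index_card[OF AB] by simp
    then obtain s where s: "?T = {s}" by (auto simp: card_1_singleton_iff)
    have sk: "s \<in> {1..?k}" using join_index_subset[OF AB] s by auto
    have "d 2 ?w (A, B) = koszul_sum R y ?k (flat ?w) ?T" by (rule d_flat[OF w AB'])
    also have "\<dots> = koszul_sum R y ?k b ?T"
    proof (rule koszul_sum_cong)
      fix t assume t: "t \<in> {1..?k} - ?T"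
      have "join_index k1 (split_index k1 k2 (insert t ?T)) = insert t ?T"
        using t join_index_subset[OF AB] by (intro join_split_index) auto
      then show "flat ?w (insert t ?T) = b (insert t ?T)"
        using split_insert_join_mem[OF AB' t] by simp
    qed (use b(1) y_carrier in auto)
    also have "\<dots> = c (A, B)" using b(2)[OF sk] split_join_index[OF AB] s by simp
    finally show "d 2 ?w (A, B) = c (A, B)" .
  qed (use c d_closed[OF w] in auto)
  then show ?thesis using w by blast
qed

text \<open>The map \<open>aug\<close> sends \<open>cyc 1\<close> onto \<open>X \<inter> U\<close> and \<open>F 1\<close> onto \<open>V\<close>. Its kernel consists of boundaries by
exactness in degree one, so \<open>bnd 1\<close> is the full preimage of \<open>V\<close>, and \<open>aug\<close> induces an isomorphism
from the first homology to \<open>(X \<inter> U) / V\<close>.\<close>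

theorem interval_length_homology_1:
  assumes reg: "regular_sequence R (k1 + k2) y"
  shows "interval_length R (K 1) (bnd 1) (cyc 1) = interval_length R (self_module R) V (X \<inter> U)"
    and "V \<subseteq> X \<inter> U"
proof -
  have aug_U: "aug c \<in> U \<longleftrightarrow> d 1 c \<in> F 0" if "c \<in> carrier (K 1)" for c
    using F0_iff[OF d_1_closed[OF that]] by (simp add: aug_def)
  show VXU: "V \<subseteq> X \<inter> U"
  proof -
    have "V \<subseteq> X" unfolding aug_F[symmetric] aug_image[symmetric] using F_carrier by (rule image_mono)
    moreover have "aug c \<in> U" if "c \<in> F 1" for c
      using aug_U[of c] d_F[OF that] F_carrier that by auto
    then have "V \<subseteq> U" unfolding aug_F[symmetric] by blast
    ultimately show ?thesis by (rule Int_greatest)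
  qed
  have cyc: "cyc 1 = {c \<in> carrier (K 1). aug c \<in> X \<inter> U}"
    using aug_U aug_image by (auto simp: cyc_def)
  have bnd: "bnd 1 = {c \<in> carrier (K 1). aug c \<in> V}"
  proof
    show "bnd 1 \<subseteq> {c \<in> carrier (K 1). aug c \<in> V}"
    proof
      fix c assume c: "c \<in> bnd 1"
      then obtain f w where fw: "f \<in> F 1" "w \<in> carrier (K 2)" "c = f \<oplus>\<^bsub>K 1\<^esub> d 2 w"
        by (auto simp: bnd_def set_add_def')
      have fK: "f \<in> carrier (K 1)" using fw F_carrier by auto
      have dw: "d 2 w \<in> carrier (K 1)" using d_closed[OF fw(2)] by simp
      have "d 1 (d 2 w) = \<zero>\<^bsub>K 0\<^esub>" using d_d[OF fw(2)] by simp
      then have "aug (d 2 w) = \<zero>" by (simp add: aug_def koszul_def kos_index_0)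
      then have "aug c = aug f"
        using aug.add[OF fK dw] fw(3) aug.closed[OF fK] by (simp add: self_module_def)
      then have "aug c \<in> V" using aug_F fw(1) by blast
      moreover have "c \<in> carrier (K 1)" using c K.submodule_subset[OF bnd_submodule] by blast
      ultimately show "c \<in> {c \<in> carrier (K 1). aug c \<in> V}" by simp
    qed
    show "{c \<in> carrier (K 1). aug c \<in> V} \<subseteq> bnd 1"
    proof
      fix c assume "c \<in> {c \<in> carrier (K 1). aug c \<in> V}"
      then obtain f where c: "c \<in> carrier (K 1)" and f: "f \<in> F 1" "aug c = aug f"
        unfolding aug_F[symmetric] by blast
      have fK: "f \<in> carrier (K 1)" using f F_carrier by auto
      have cf: "c \<ominus>\<^bsub>K 1\<^esub> f \<in> carrier (K 1)" using c fK by (rule K.M.minus_closed)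
      have "aug (c \<ominus>\<^bsub>K 1\<^esub> f) = \<zero>"
        using aug.map_diff[OF c fK] f(2) aug.closed[OF fK] eval.N.r_neg[OF aug.closed[OF fK]]
        by (simp add: a_minus_def self_module_def)
      then obtain w where w: "w \<in> carrier (K 2)" "d 2 w = c \<ominus>\<^bsub>K 1\<^esub> f" using koszul_exact_1[OF reg cf] by blast
      have "c = f \<oplus>\<^bsub>K 1\<^esub> d 2 w"
        using w(2) c fK by (simp add: a_minus_def K.M.a_comm[of c] K.M.r_neg2)
      then show "c \<in> bnd 1" using f(1) w(1) by (auto simp: bnd_def set_add_def')
    qed
  qed
  have XU: "ideal (X \<inter> U) R" by (intro i_intersect X_ideal filt_ideal)
  show "interval_length R (K 1) (bnd 1) (cyc 1) = interval_length R (self_module R) V (X \<inter> U)"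
    unfolding bnd cyc
  proof (rule aug.interval_length_preimage[symmetric])
    show sub: "submodule V R (self_module R)" "submodule (X \<inter> U) R (self_module R)"
      using V_ideal XU by (auto simp: submodule_self_iff)
    show "X \<inter> U \<subseteq> V <+>\<^bsub>self_module R\<^esub> aug ` carrier (K 1)"
      using aug_image eval.N.set_add_subset_right[OF sub(1) aug.image_submodule[OF K.carrier_is_submodule]] by blast
  qed (rule VXU)
qed

end

theorem theorem3p2:
  fixes R :: "('a, 'c) ring_scheme" and m I1 I2 :: "'a set"
    and k1 k2 :: nat and x1 x2 :: "nat \<Rightarrow> 'a" and n1 n2 :: int
  defines "X1 \<equiv> Idl\<^bsub>R\<^esub> (x1 ` {1..k1})" and "X2 \<equiv> Idl\<^bsub>R\<^esub> (x2 ` {1..k2})"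
  assumes "cohen_macaulay_local_ring R m"
    and "infinite (carrier (R Quot m))"
    and "P_primary R m I1" and "P_primary R m I2"
    and "k1 + k2 \<ge> 1"
    and "x1 ` {1..k1} \<subseteq> I1" and "x2 ` {1..k2} \<subseteq> I2"
    and "rees_superficial_sequence R I1 I2 k1 k2 (concat_seq k1 x1 x2)"
    and "regular_sequence R (k1 + k2) (concat_seq k1 x1 x2)"
  shows "bidiff k1 k2 (hilb R I1 I2) n1 n2 =
      len R (ideal_quot R (carrier R) (bipow R I1 I2 n1 n2 <+>\<^bsub>R\<^esub> (X1 <+>\<^bsub>R\<^esub> X2)))
    - len R (ideal_quot R ((X1 <+>\<^bsub>R\<^esub> X2) \<inter> bipow R I1 I2 n1 n2)
        (X1 \<cdot>\<^bsub>R\<^esub> bipow R I1 I2 (n1 - 1) n2 <+>\<^bsub>R\<^esub> X2 \<cdot>\<^bsub>R\<^esub> bipow R I1 I2 n1 (n2 - 1)))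
    + (\<Sum>i=2..k1+k2. (- 1) ^ i * koszul_h R k1 k2 x1 x2 I1 I2 n1 n2 (int i))"
proof -
  have ring: "cring R" "noetherian_ring R" "maximalideal m R"
    using assms(3) by (auto simp: cohen_macaulay_local_ring_def noetherian_local_ring_def)
  interpret cring R by (rule ring)
  have I: "ideal I1 R" "ideal I2 R" "radical R I1 = m" "radical R I2 = m"
    using assms(5,6) by (auto simp: P_primary_def primary_ideal_def)
  interpret koszul_filtration R k1 k2 x1 x2 I1 I2 n1 n2
    by (intro koszul_filtration.intro koszul_filtration_axioms.intro ring I assms)
  have fin: "interval_length R (self_module R) (bipow R I1 I2 p q) (carrier R) \<noteq> \<infinity>" for p q
    by (rule finite_colength[OF ring(2,3) filt_ideal])
      (use radical_subset_radical_bipow[OF I(1,2), of p q] I(3,4) in simp)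
  let ?h = "koszul_h R k1 k2 x1 x2 I1 I2 n1 n2"
  have UX: "ideal (bipow R I1 I2 n1 n2 <+>\<^bsub>R\<^esub> X) R" by (intro add_ideals filt_ideal X_ideal)
  have h0: "?h 0 = len R (ideal_quot R (carrier R) (bipow R I1 I2 n1 n2 <+>\<^bsub>R\<^esub> X))"
    unfolding koszul_h_eq len_def interval_length_homology_0
    using UX ideal.axioms(1)[OF UX, THEN additive_subgroup.a_subset]
    by (subst module_length_ideal_quot) (auto simp: oneideal)
  have h1: "?h 1 = len R (ideal_quot R (X \<inter> bipow R I1 I2 n1 n2) V)"
    unfolding koszul_h_eq len_def interval_length_homology_1(1)[OF assms(11)]
      module_length_ideal_quot[OF V_ideal i_intersect[OF X_ideal filt_ideal] interval_length_homology_1(2)[OF assms(11)]] ..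
  have "{0..k1 + k2} = insert 0 (insert 1 {2..k1 + k2})" using assms(7) by auto
  then have "(\<Sum>i=0..k1 + k2. (- 1) ^ i * ?h (int i))
      = ?h 0 - ?h 1 + (\<Sum>i=2..k1 + k2. (- 1) ^ i * ?h (int i))" by simp
  then show ?thesis
    unfolding bidiff_hilb_eq_euler_characteristic[OF fin] h0 h1 X1_def X2_def by simp
qed

end
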